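(* Let $N\ge 1$, $q,t\in[0,1)$ and $a_1,\dots,a_N>0$. Any nearest neighbor `dynamics' $\{(W_k,V_k)\}_{k=1}^N$ on interlacing arrays of depth $N$ can be obtained as a mixing of the fundamental nearest neighbor `dynamics', which are: the push-block dynamics $\mathsf{PB}$; the $N!$ RSK-type `dynamics' $\mathsf{RSK}[\boldsymbol h]$, $\boldsymbol h\in\{1\}\times\{1,2\}\times\dots\times\{1,\dots,N\}$; the $(N-1)!$ right-pushing `dynamics' $\mathsf{R}[\boldsymbol h]$, $\boldsymbol h\in\{1\}\times\{1,2\}\times\dots\times\{1,\dots,N-1\}$; and the $(N-1)!$ left-pulling `dynamics' $\mathsf{L}[\boldsymbol h]$, $\boldsymbol h\in\{1\}\times\{1,2\}\times\dots\times\{1,\dots,N-1\}$.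
   Context: **Signatures.** $\mathbb{GT}_k=\{\lambda\in\mathbb Z^k:\lambda_1\ge\dots\ge\lambda_k\}$, $\mathbb{GT}_0=\{\varnothing\}$, $|\lambda|=\sum\lambda_i$. For $\bar\lambda\in\mathbb{GT}_{k-1},\lambda\in\mathbb{GT}_k$, $\bar\lambda\prec\lambda$ means $\lambda_{i+1}\le\bar\lambda_i\le\lambda_i$ for $1\le i\le k-1$ (and $\varnothing\prec\lambda$ for all $\lambda\in\mathbb{GT}_1$). $\mathrm e_j$ (resp. $\bar{\mathrm e}_i$) is the $j$th (resp. $i$th) standard basis vector of $\mathbb Z^k$ (resp. $\mathbb Z^{k-1}$). Interlacing arrays of depth $N$ are sequences $\lambda^{(1)}\prec\dots\prec\lambda^{(N)}$, $\lambda^{(k)}\in\mathbb{GT}_k$. **Macdonald quantities.** $(a;q)_\infty=\prod_{i\ge0}(1-aq^i)$, $f(u)=(tu;q)_\infty/(qu;q)_\infty$, $0^0=1$. For $\kappa\in\mathbb{GT}_{m-1}$, $\nu\in\mathbb{GT}_m$, $\kappa\prec\nu$: $\psi_{\nu/\kappa}=\prod_{1\le i\le j\le m-1}\frac{f(q^{\kappa_i-\kappa_j}t^{j-i})f(q^{\nu_i-\nu_{j+1}}t^{j-i})}{f(q^{\nu_i-\kappa_j}t^{j-i})f(q^{\kappa_i-\nu_{j+1}}t^{j-i})}$; $\psi_{\nu/\kappa}=0$ if $\kappa\not\prec\nu$ (or if $\kappa$ or $\nu$ is not a signature). For signatures $\mu$ and $\mu+\mathrm e_j$: $\psi'_{\mu+\mathrm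 e_j/\mu}=\prod_{i=1}^{j-1}\frac{(1-q^{\mu_i-\mu_j}t^{j-i-1})(1-q^{\mu_i-\mu_j-1}t^{j-i+1})}{(1-q^{\mu_i-\mu_j}t^{j-i})(1-q^{\mu_i-\mu_j-1}t^{j-i})}$; it is $0$ if one of $\mu,\mu+\mathrm e_j$ is not a signature. Macdonald (Laurent) polynomial: for $\lambda\in\mathbb{GT}_k$, $P_\lambda(a_1,\dots,a_k)=\sum_{\lambda^{(1)}\prec\dots\prec\lambda^{(k)}=\lambda}\prod_{i=1}^k\psi_{\lambda^{(i)}/\lambda^{(i-1)}}a_i^{|\lambda^{(i)}|-|\lambda^{(i-1)}|}$ (with $\lambda^{(0)}=\varnothing$). **Links and univariate rates.** $\Lambda^k_{k-1}(\lambda,\bar\lambda)=\frac{P_{\bar\lambda}(a_1,\dots,a_{k-1})}{P_\lambda(a_1,\dots,a_k)}\psi_{\lambda/\bar\lambda}a_k^{|\lambda|-|\bar\lambda|}$; $\Lambda^1_0\equiv1$. For $\lambda\ne\nu$ in $\mathbb{GT}_k$: $Q_k(\lambda,\nu)=\frac{P_\nu(a_1,\dots,a_k)}{P_\lambda(a_1,\dots,a_k)}\psi'_{\nu/\lambda}$ if $\nu=\lambda+\mathrm e_j$ for some $j$, and $0$ otherwise; $Q_k(\lambda,\lambda)=-\sum_{\nu\ne\lambda}Q_k(\lambda,\nu)$; $Q_0=0$. **`Dynamics'.** A (formal, positivity not required) multivariate `dynamics' is a collection of real functions $W_k(\lambda,\nu\,|\,\bar\lambda)$ (rates of independent jumps)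 and $V_k(\lambda,\nu\,|\,\bar\lambda,\bar\nu)$ (probabilities of triggered moves), $k=1,\dots,N$ ($\lambda,\nu\in\mathbb{GT}_k$; $\bar\lambda,\bar\nu\in\mathbb{GT}_{k-1}$; $\bar\lambda\prec\lambda$; $\bar\nu=\bar\lambda$ or $\bar\nu=\bar\lambda+\bar{\mathrm e}_i$; for $k=1$ there is only $W_1$), such that: both vanish unless $\nu=\lambda$ or $\nu=\lambda+\mathrm e_j$ for some $j$; $V_k=0$ unless $\bar\nu\prec\nu$, $W_k=0$ unless $\bar\lambda\prec\nu$; $\sum_\nu V_k(\lambda,\nu|\bar\lambda,\bar\nu)=1$; $V_k(\lambda,\nu|\bar\lambda,\bar\lambda)=1_{\lambda=\nu}$; $\sum_{\nu\ne\lambda}W_k(\lambda,\nu|\bar\lambda)=-W_k(\lambda,\lambda|\bar\lambda)$; and for all $\lambda,\nu,\bar\nu$ with $\bar\nu\prec\nu$ $$\sum_{\bar\lambda}V_k(\lambda,\nu|\bar\lambda,\bar\nu)\Lambda^k_{k-1}(\lambda,\bar\lambda)Q_{k-1}(\bar\lambda,\bar\nu)+W_k(\lambda,\nu|\bar\nu)\Lambda^k_{k-1}(\lambda,\bar\nu)=Q_k(\lambda,\nu)\Lambda^k_{k-1}(\nu,\bar\nu).$$ This forces the short-range pushing rule: if $\bar\nu\not\prec\lambda$, $\bar\nu-\bar{\mathrm e}_j\prec\lambda$, $\bar\nu\prec\lambda+\mathrm e_j$, then $V_k(\lambda,\lambda+\mathrm e_j|\bar\nu-\bar{\mathrm e}_j,\bar\nu)=1$;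 all `dynamics' below obey this rule, and it remains to specify $V_k,W_k$ for $\bar\nu\prec\lambda$. On level $k=1$ all `dynamics' coincide. **Nearest neighbor.** For $\bar\nu\prec\lambda$ put $\mathscr F=\mathscr F(\bar\nu,\lambda)=\{j\in\{1,\dots,k\}:\lambda_j<\bar\nu_{j-1}\}$ (with $\bar\nu_0=+\infty$, so $1\in\mathscr F$) and $\xi(i)=\max\{j\le i:j\in\mathscr F\}$. A `dynamics' is nearest neighbor if for all $k\ge2$, $\bar\nu\prec\lambda$ and $j$ with $j+1\in\mathscr F$, $V_k(\lambda,\lambda+\mathrm e_m|\bar\nu-\bar{\mathrm e}_j,\bar\nu)=0$ unless $m=j+1$ or $m=\xi(j)$. **Fundamental `dynamics'.** For $\bar\nu\prec\lambda$ let $T_i=T_i(\bar\nu,\lambda)=\frac{\psi_{\lambda/\bar\nu-\bar{\mathrm e}_i}}{\psi_{\lambda/\bar\nu}}\psi'_{\bar\nu/\bar\nu-\bar{\mathrm e}_i}$, $S_j=S_j(\bar\nu,\lambda)=\frac{\psi_{\lambda+\mathrm e_j/\bar\nu}}{\psi_{\lambda/\bar\nu}}\psi'_{\lambda+\mathrm e_j/\lambda}$. ($S_j$ and $T_{j-1}$ are positive if $j\in\mathscr F$ and zero otherwise.) On the slice of levels $k-1,k$ ($k\ge2$), for $\bar\nu\prec\lambda$, $m\in\mathscr F$, $j+1\in\mathscr F$ (off-diagonal values listed; the diagonal ones are determined by the sum conditions): - $\mathsf{PB}$: $V_k(\lambda,\lambda+\mathrm e_m|\bar\nu-\bar{\mathrm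 e}_j,\bar\nu)=0$, $W_k(\lambda,\lambda+\mathrm e_m|\bar\nu)=a_kS_m$. - $\mathsf{RSK}(h)$, $1\le h\le k$: $V_k(\lambda,\lambda+\mathrm e_m|\bar\nu-\bar{\mathrm e}_j,\bar\nu)=r_j1_{m=\xi(j)}+(1-r_j)1_{m=j+1}$ with $r_j=T_j^{-1}(S_1+\dots+S_j-T_1-\dots-T_{j-1}-1_{h\le j})$; $W_k(\lambda,\lambda+\mathrm e_m|\bar\nu)=a_k1_{\xi(h)=m}$. - $\mathsf R(h)$, $1\le h\le k-1$: $V_k(\lambda,\lambda+\mathrm e_m|\bar\nu-\bar{\mathrm e}_j,\bar\nu)=1_{j=h}1_{m=\xi(h)}$, $W_k(\lambda,\lambda+\mathrm e_m|\bar\nu)=a_k(S_m-1_{m=\xi(h)}T_h)$. - $\mathsf L(h)$, $1\le h\le k-1$: $V_k(\lambda,\lambda+\mathrm e_m|\bar\nu-\bar{\mathrm e}_j,\bar\nu)=1_{j=h}1_{m=h+1}$, $W_k(\lambda,\lambda+\mathrm e_m|\bar\nu)=a_k(S_m-1_{m=h+1}T_h)$. $\mathsf{RSK}[\boldsymbol h]$ with $\boldsymbol h=(h^{(1)},\dots,h^{(N)})$ uses $\mathsf{RSK}(h^{(k)})$ on the slice of levels $k-1,k$; $\mathsf R[\boldsymbol h]$, $\mathsf L[\boldsymbol h]$ with $\boldsymbol h=(h^{(1)},\dots,h^{(N-1)})$ use $\mathsf R(h^{(k-1)})$, $\mathsf L(h^{(k-1)})$ there, for each $k=2,\dots,N$.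 **Mixing.** A `dynamics' $\{(\tilde W_k,\tilde V_k)\}$ is a mixing of finitely many `dynamics' $\{(W_k^{\alpha},V_k^{\alpha})\}_{\alpha}$ if for each $k=2,\dots,N$ there are real functions $\theta^{(k)}_\alpha(\bar\nu,\lambda)$ on pairs $\bar\nu\prec\lambda$ with $\sum_\alpha\theta^{(k)}_\alpha\equiv1$ such that, for $\bar\nu\prec\lambda$, $\tilde W_k(\lambda,\nu|\bar\nu)=\sum_\alpha\theta^{(k)}_\alpha(\bar\nu,\lambda)W_k^\alpha(\lambda,\nu|\bar\nu)$ and $\tilde V_k(\lambda,\nu|\bar\lambda,\bar\nu)=\sum_\alpha\theta^{(k)}_\alpha(\bar\nu,\lambda)V_k^\alpha(\lambda,\nu|\bar\lambda,\bar\nu)$. *)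

theory Defs
  imports "HOL-Analysis.Analysis"
begin

section \<open>Signatures and interlacing\<close>

text \<open>
  Coordinates are numbered from 1, as in \<open>\<lambda> = (\<lambda>\<^sub>1, \<dots>, \<lambda>\<^sub>k)\<close>, and a signature is extended by 0
  outside \<open>{1..k}\<close>; this makes its representation unique. The only element of \<open>GT 0\<close> is the zero
  function, playing the role of the empty signature. Since the zero function is also in \<open>GT k\<close>
  for every \<open>k\<close>, the level \<open>k\<close> is always passed explicitly.
\<close>

type_synonym signature = "nat \<Rightarrow> int"

definition GT :: "nat \<Rightarrow> signature set" where
  "GT k = {l. (\<forall>i. i \<notin> {1..k} \<longrightarrow> l i = 0) \<and> (\<forall>i. 1 \<le> i \<and> i < k \<longrightarrow> l (i + 1) \<le> l i)}"

definition weight :: "nat \<Rightarrow> signature \<Rightarrow> int" where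
  "weight k l = (\<Sum>i = 1..k. l i)"

definition interlaces :: "nat \<Rightarrow> signature \<Rightarrow> signature \<Rightarrow> bool" where
  "interlaces k lb l \<longleftrightarrow> lb \<in> GT (k - 1) \<and> l \<in> GT k \<and>
     (\<forall>i \<in> {1..k - 1}. l (i + 1) \<le> lb i \<and> lb i \<le> l i)"

text \<open>\<open>up j l\<close> and \<open>down j l\<close> are \<open>l + e\<^sub>j\<close> and \<open>l - e\<^sub>j\<close>; they need not be signatures.\<close>

definition up :: "nat \<Rightarrow> signature \<Rightarrow> signature" where
  "up j l = l(j := l j + 1)"

definition down :: "nat \<Rightarrow> signature \<Rightarrow> signature" where
  "down j l = l(j := l j - 1)"

text \<open>
  The signatures \<open>l\<close> and \<open>l + e\<^sub>j\<close>. All transition rates and probabilities out of \<open>l\<close> vanish outside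
  this finite set, so sums over all \<open>\<nu> \<in> GT k\<close> are written as sums over it.
\<close>

definition steps :: "nat \<Rightarrow> signature \<Rightarrow> signature set" where
  "steps k l = {n \<in> GT k. n = l \<or> (\<exists>j \<in> {1..k}. n = up j l)}"

section \<open>Macdonald quantities\<close>

definition qpoch_inf :: "real \<Rightarrow> real \<Rightarrow> real" where
  "qpoch_inf x q = (\<Prod>i. 1 - x * q ^ i)"

definition mac_f :: "real \<Rightarrow> real \<Rightarrow> real \<Rightarrow> real" where
  "mac_f q t u = qpoch_inf (t * u) q / qpoch_inf (q * u) q"

text \<open>
  \<open>psi q t m n kp\<close> is \<open>\<psi>\<^bsub>\<nu>/\<kappa>\<^esub>\<close> with \<open>\<nu> \<in> GT m\<close>, \<open>\<kappa> \<in> GT (m - 1)\<close>. All exponents of \<open>q\<close> are nonnegative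
  when \<open>\<kappa> \<prec> \<nu>\<close>, and \<open>0 powi 0 = 1\<close>.
\<close>

definition psi :: "real \<Rightarrow> real \<Rightarrow> nat \<Rightarrow> signature \<Rightarrow> signature \<Rightarrow> real" where
  "psi q t m n kp =
     (if interlaces m kp n then
        \<Prod>(i, j) \<in> {(i, j). 1 \<le> i \<and> i \<le> j \<and> j \<le> m - 1}.
          (mac_f q t (q powi (kp i - kp j) * t ^ (j - i)) *
           mac_f q t (q powi (n i - n (j + 1)) * t ^ (j - i))) /
          (mac_f q t (q powi (n i - kp j) * t ^ (j - i)) *
           mac_f q t (q powi (kp i - n (j + 1)) * t ^ (j - i)))
      else 0)"

text \<open>\<open>psi' q t k j m\<close> is \<open>\<psi>'\<^bsub>\<mu>+e\<^sub>j/\<mu>\<^esub>\<close> with \<open>\<mu> \<in> GT k\<close>.\<close>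

definition psi' :: "real \<Rightarrow> real \<Rightarrow> nat \<Rightarrow> nat \<Rightarrow> signature \<Rightarrow> real" where
  "psi' q t k j m =
     (if m \<in> GT k \<and> up j m \<in> GT k then
        \<Prod>i = 1..<j.
          ((1 - q powi (m i - m j) * t ^ (j - i - 1)) *
           (1 - q powi (m i - m j - 1) * t ^ (j - i + 1))) /
          ((1 - q powi (m i - m j) * t ^ (j - i)) *
           (1 - q powi (m i - m j - 1) * t ^ (j - i)))
      else 0)"

text \<open>Interlacing arrays of depth \<open>k\<close> with top row \<open>l\<close>, extended by zero rows beyond level \<open>k\<close>.\<close>

definition arrays :: "nat \<Rightarrow> signature \<Rightarrow> (nat \<Rightarrow> signature) set" where
  "arrays k l = {A. A 0 = (\<lambda>_. 0) \<and> (\<forall>i \<in> {1..k}. interlaces i (A (i - 1)) (A i)) \<and>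
                    A k = l \<and> (\<forall>i > k. A i = (\<lambda>_. 0))}"

definition mac_P :: "real \<Rightarrow> real \<Rightarrow> (nat \<Rightarrow> real) \<Rightarrow> nat \<Rightarrow> signature \<Rightarrow> real" where
  "mac_P q t a k l =
     (\<Sum>A \<in> arrays k l. \<Prod>i = 1..k.
        psi q t i (A i) (A (i - 1)) * a i powi (weight i (A i) - weight (i - 1) (A (i - 1))))"

section \<open>Links and univariate rates\<close>

definition link :: "real \<Rightarrow> real \<Rightarrow> (nat \<Rightarrow> real) \<Rightarrow> nat \<Rightarrow> signature \<Rightarrow> signature \<Rightarrow> real" where
  "link q t a k l lb =
     (if k = 1 then 1
      else mac_P q t a (k - 1) lb / mac_P q t a k l * psi q t k l lb *
           a k powi (weight k l - weight (k - 1) lb))"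

text \<open>The sum below has at most one term; it is empty unless \<open>n = l + e\<^sub>j\<close> for some \<open>j\<close>.\<close>

definition offdiag_rate ::
    "real \<Rightarrow> real \<Rightarrow> (nat \<Rightarrow> real) \<Rightarrow> nat \<Rightarrow> signature \<Rightarrow> signature \<Rightarrow> real" where
  "offdiag_rate q t a k l n =
     (\<Sum>j | j \<in> {1..k} \<and> n = up j l. mac_P q t a k n / mac_P q t a k l * psi' q t k j l)"

text \<open>For \<open>k = 0\<close> all sums are empty, so that \<open>Q\<^sub>0 = 0\<close>.\<close>

definition uni_rate ::
    "real \<Rightarrow> real \<Rightarrow> (nat \<Rightarrow> real) \<Rightarrow> nat \<Rightarrow> signature \<Rightarrow> signature \<Rightarrow> real" where
  "uni_rate q t a k l n =
     (if n = l then - (\<Sum>n' \<in> steps k l - {l}. offdiag_rate q t a k l n')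
      else offdiag_rate q t a k l n)"

section \<open>Multivariate `dynamics'\<close>

text \<open>
  \<open>rateW D k l n lb\<close> is \<open>W\<^sub>k(\<lambda>, \<nu> | \<lambda>')\<close> and \<open>trigV D k l n lb nb\<close> is \<open>V\<^sub>k(\<lambda>, \<nu> | \<lambda>', \<nu>')\<close>, where \<open>\<lambda>', \<nu>'\<close>
  are signatures of level \<open>k - 1\<close>. These functions are meaningful only for \<open>\<lambda>' \<prec> \<lambda>\<close> and
  \<open>\<nu>' \<in> steps (k - 1) \<lambda>'\<close> (and, for \<open>trigV\<close>, \<open>k \<ge> 2\<close>); nothing below depends on other values: in
  \<open>consistent\<close> they are multiplied by a vanishing link or univariate rate.
\<close>

record mdyn =
  rateW :: "nat \<Rightarrow> signature \<Rightarrow> signature \<Rightarrow> signature \<Rightarrow> real"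
  trigV :: "nat \<Rightarrow> signature \<Rightarrow> signature \<Rightarrow> signature \<Rightarrow> signature \<Rightarrow> real"

definition consistent :: "real \<Rightarrow> real \<Rightarrow> (nat \<Rightarrow> real) \<Rightarrow> nat \<Rightarrow> mdyn \<Rightarrow> bool" where
  "consistent q t a k D \<longleftrightarrow>
     (\<forall>l \<in> GT k. \<forall>n \<in> GT k. \<forall>nb. interlaces k nb n \<longrightarrow>
        (\<Sum>lb | interlaces k lb l.
           trigV D k l n lb nb * link q t a k l lb * uni_rate q t a (k - 1) lb nb)
        + rateW D k l n nb * link q t a k l nb
        = uni_rate q t a k l n * link q t a k n nb)"

definition dynamics :: "real \<Rightarrow> real \<Rightarrow> (nat \<Rightarrow> real) \<Rightarrow> nat \<Rightarrow> mdyn \<Rightarrow> bool" where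
  "dynamics q t a N D \<longleftrightarrow>
     (\<forall>k \<in> {1..N}. \<forall>l lb. interlaces k lb l \<longrightarrow>
        (\<forall>n \<in> GT k. n \<notin> steps k l \<or> \<not> interlaces k lb n \<longrightarrow> rateW D k l n lb = 0) \<and>
        (\<Sum>n \<in> steps k l - {l}. rateW D k l n lb) = - rateW D k l l lb) \<and>
     (\<forall>k \<in> {2..N}. \<forall>l lb. \<forall>nb \<in> steps (k - 1) lb. interlaces k lb l \<longrightarrow>
        (\<forall>n \<in> GT k. n \<notin> steps k l \<or> \<not> interlaces k nb n \<longrightarrow> trigV D k l n lb nb = 0) \<and>
        (\<Sum>n \<in> steps k l. trigV D k l n lb nb) = 1 \<and>
        (\<forall>n \<in> GT k. trigV D k l n lb lb = of_bool (l = n))) \<and>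
     (\<forall>k \<in> {1..N}. consistent q t a k D)"

section \<open>Nearest neighbor `dynamics'\<close>

text \<open>\<open>Fset k nb l\<close> is \<open>\<F>(\<nu>', \<lambda>)\<close>, with the convention \<open>\<nu>'\<^sub>0 = +\<infinity>\<close>.\<close>

definition Fset :: "nat \<Rightarrow> signature \<Rightarrow> signature \<Rightarrow> nat set" where
  "Fset k nb l = {j \<in> {1..k}. j = 1 \<or> l j < nb (j - 1)}"

definition xi :: "nat \<Rightarrow> signature \<Rightarrow> signature \<Rightarrow> nat \<Rightarrow> nat" where
  "xi k nb l i = Max {j \<in> Fset k nb l. j \<le> i}"

definition nearest_neighbor :: "real \<Rightarrow> real \<Rightarrow> (nat \<Rightarrow> real) \<Rightarrow> nat \<Rightarrow> mdyn \<Rightarrow> bool" where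
  "nearest_neighbor q t a N D \<longleftrightarrow> dynamics q t a N D \<and>
     (\<forall>k \<in> {2..N}. \<forall>l nb. interlaces k nb l \<longrightarrow>
        (\<forall>j \<in> {1..k - 1}. j + 1 \<in> Fset k nb l \<longrightarrow>
           (\<forall>m \<in> {1..k}. up m l \<in> GT k \<and> m \<noteq> j + 1 \<and> m \<noteq> xi k nb l j \<longrightarrow>
              trigV D k l (up m l) (down j nb) nb = 0)))"

section \<open>Fundamental `dynamics'\<close>

definition T_coef :: "real \<Rightarrow> real \<Rightarrow> nat \<Rightarrow> signature \<Rightarrow> signature \<Rightarrow> nat \<Rightarrow> real" where
  "T_coef q t k nb l i =
     psi q t k l (down i nb) / psi q t k l nb * psi' q t (k - 1) i (down i nb)"

definition S_coef :: "real \<Rightarrow> real \<Rightarrow> nat \<Rightarrow> signature \<Rightarrow> signature \<Rightarrow> nat \<Rightarrow> real" where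
  "S_coef q t k nb l j = psi q t k (up j l) nb / psi q t k l nb * psi' q t k j l"

text \<open>The rule used on a single slice of levels \<open>k - 1, k\<close>.\<close>

datatype slice_rule = PB | RSK nat | RPush nat | LPull nat

definition rsk_r :: "real \<Rightarrow> real \<Rightarrow> nat \<Rightarrow> nat \<Rightarrow> signature \<Rightarrow> signature \<Rightarrow> nat \<Rightarrow> real" where
  "rsk_r q t h k nb l j =
     inverse (T_coef q t k nb l j) *
     ((\<Sum>i = 1..j. S_coef q t k nb l i) - (\<Sum>i = 1..<j. T_coef q t k nb l i) - of_bool (h \<le> j))"

text \<open>\<open>slice_W q t a rule k nb l m\<close> is \<open>W\<^sub>k(\<lambda>, \<lambda> + e\<^sub>m | \<nu>')\<close> for \<open>\<nu>' \<prec> \<lambda>\<close> and \<open>m \<in> \<F>(\<nu>', \<lambda>)\<close>.\<close>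

fun slice_W ::
    "real \<Rightarrow> real \<Rightarrow> (nat \<Rightarrow> real) \<Rightarrow> slice_rule \<Rightarrow> nat \<Rightarrow> signature \<Rightarrow> signature \<Rightarrow> nat \<Rightarrow> real" where
  "slice_W q t a PB k nb l m = a k * S_coef q t k nb l m"
| "slice_W q t a (RSK h) k nb l m = a k * of_bool (xi k nb l h = m)"
| "slice_W q t a (RPush h) k nb l m =
     a k * (S_coef q t k nb l m - of_bool (m = xi k nb l h) * T_coef q t k nb l h)"
| "slice_W q t a (LPull h) k nb l m =
     a k * (S_coef q t k nb l m - of_bool (m = h + 1) * T_coef q t k nb l h)"

text \<open>
  \<open>slice_V q t rule k nb l j m\<close> is \<open>V\<^sub>k(\<lambda>, \<lambda> + e\<^sub>m | \<nu>' - e\<^sub>j, \<nu>')\<close> for \<open>\<nu>' \<prec> \<lambda>\<close> and \<open>m, j + 1 \<in> \<F>(\<nu>', \<lambda>)\<close>.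
\<close>

fun slice_V ::
    "real \<Rightarrow> real \<Rightarrow> slice_rule \<Rightarrow> nat \<Rightarrow> signature \<Rightarrow> signature \<Rightarrow> nat \<Rightarrow> nat \<Rightarrow> real" where
  "slice_V q t PB k nb l j m = 0"
| "slice_V q t (RSK h) k nb l j m =
     rsk_r q t h k nb l j * of_bool (m = xi k nb l j) +
     (1 - rsk_r q t h k nb l j) * of_bool (m = j + 1)"
| "slice_V q t (RPush h) k nb l j m = of_bool (j = h) * of_bool (m = xi k nb l h)"
| "slice_V q t (LPull h) k nb l j m = of_bool (j = h) * of_bool (m = h + 1)"

text \<open>
  The `dynamics' using the rule \<open>\<rho> k\<close> on the slice of levels \<open>k - 1, k\<close>. Level 1 evolves according
  to \<open>Q\<^sub>1\<close>; diagonal values are determined by the sum conditions; for \<open>\<nu>' \<nprec> \<lambda>\<close> the short-range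
  pushing rule applies. The index sets selecting \<open>m\<close> with \<open>\<nu> = \<lambda> + e\<^sub>m\<close>, and \<open>j\<close> with
  \<open>\<nu>' = \<lambda>' + e\<^sub>j\<close>, have at most one element; if \<open>\<lambda>', \<nu>' \<prec> \<lambda>\<close> then \<open>j + 1 \<in> \<F>(\<nu>', \<lambda>)\<close>.
\<close>

definition dyn_of :: "real \<Rightarrow> real \<Rightarrow> (nat \<Rightarrow> real) \<Rightarrow> (nat \<Rightarrow> slice_rule) \<Rightarrow> mdyn" where
  "dyn_of q t a \<rho> =
     \<lparr>rateW = (\<lambda>k l n lb.
        if k = 1 then uni_rate q t a 1 l n
        else if n = l then - (\<Sum>m \<in> Fset k lb l. slice_W q t a (\<rho> k) k lb l m)
        else (\<Sum>m | m \<in> Fset k lb l \<and> n = up m l. slice_W q t a (\<rho> k) k lb l m)),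
      trigV = (\<lambda>k l n lb nb.
        if nb = lb then of_bool (n = l)
        else if \<not> interlaces k nb l then
          of_bool (\<exists>j \<in> {1..k - 1}. nb = up j lb \<and> n = up j l)
        else (\<Sum>j | j \<in> {1..k - 1} \<and> nb = up j lb.
          if n = l then 1 - (\<Sum>m \<in> Fset k nb l. slice_V q t (\<rho> k) k nb l j m)
          else (\<Sum>m | m \<in> Fset k nb l \<and> n = up m l. slice_V q t (\<rho> k) k nb l j m)))\<rparr>"

definition PB_rules :: "(nat \<Rightarrow> slice_rule) set" where
  "PB_rules = {\<lambda>k. PB}"

definition RSK_rules :: "nat \<Rightarrow> (nat \<Rightarrow> slice_rule) set" where
  "RSK_rules N = (\<lambda>h k. RSK (h k)) ` (\<Pi>\<^sub>E i \<in> {1..N}. {1..i})"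

definition RPush_rules :: "nat \<Rightarrow> (nat \<Rightarrow> slice_rule) set" where
  "RPush_rules N = (\<lambda>h k. RPush (h (k - 1))) ` (\<Pi>\<^sub>E i \<in> {1..N - 1}. {1..i})"

definition LPull_rules :: "nat \<Rightarrow> (nat \<Rightarrow> slice_rule) set" where
  "LPull_rules N = (\<lambda>h k. LPull (h (k - 1))) ` (\<Pi>\<^sub>E i \<in> {1..N - 1}. {1..i})"

definition fundamental_rules :: "nat \<Rightarrow> (nat \<Rightarrow> slice_rule) set" where
  "fundamental_rules N = PB_rules \<union> RSK_rules N \<union> RPush_rules N \<union> LPull_rules N"

lemma card_boxes: "card (\<Pi>\<^sub>E i \<in> {1..N}. {1..i}) = (fact N :: nat)"
  by (simp add: card_PiE fact_prod)

lemma inj_shift: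
  assumes "inj c"
  shows "inj (\<lambda>(h :: nat \<Rightarrow> nat) k :: nat. c (h (k - 1)))"
proof (rule injI, rule ext)
  fix h h' :: "nat \<Rightarrow> nat" and i
  assume "(\<lambda>k. c (h (k - 1))) = (\<lambda>k. c (h' (k - 1)))"
  from fun_cong[OF this, of "i + 1"] show "h i = h' i"
    using assms by (simp add: inj_eq)
qed

lemma card_RSK_rules: "card (RSK_rules N) = fact N"
proof -
  have "inj (\<lambda>h k. RSK (h k))"
    by (auto intro!: injI simp: fun_eq_iff)
  then show ?thesis
    unfolding RSK_rules_def by (metis card_boxes card_image inj_on_subset subset_UNIV)
qed

lemma card_RPush_rules: "card (RPush_rules N) = fact (N - 1)"
proof -
  have "inj (\<lambda>(h :: nat \<Rightarrow> nat) k :: nat. RPush (h (k - 1)))"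
    by (rule inj_shift) (simp add: inj_def)
  then show ?thesis
    unfolding RPush_rules_def by (metis card_boxes card_image inj_on_subset subset_UNIV)
qed

lemma card_LPull_rules: "card (LPull_rules N) = fact (N - 1)"
proof -
  have "inj (\<lambda>(h :: nat \<Rightarrow> nat) k :: nat. LPull (h (k - 1)))"
    by (rule inj_shift) (simp add: inj_def)
  then show ?thesis
    unfolding LPull_rules_def by (metis card_boxes card_image inj_on_subset subset_UNIV)
qed

section \<open>Mixing\<close>

definition mixing ::
    "real \<Rightarrow> real \<Rightarrow> (nat \<Rightarrow> real) \<Rightarrow> nat \<Rightarrow> 'i set \<Rightarrow> ('i \<Rightarrow> mdyn) \<Rightarrow> mdyn \<Rightarrow> bool" where
  "mixing q t a N I D E \<longleftrightarrow>
     finite I \<and> (\<forall>\<alpha> \<in> I. dynamics q t a N (D \<alpha>)) \<and> dynamics q t a N E \<and>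
     (\<exists>\<theta> :: nat \<Rightarrow> 'i \<Rightarrow> signature \<Rightarrow> signature \<Rightarrow> real.
        \<forall>k \<in> {2..N}. \<forall>l nb. interlaces k nb l \<longrightarrow>
          (\<Sum>\<alpha> \<in> I. \<theta> k \<alpha> nb l) = 1 \<and>
          (\<forall>n \<in> GT k. rateW E k l n nb = (\<Sum>\<alpha> \<in> I. \<theta> k \<alpha> nb l * rateW (D \<alpha>) k l n nb)) \<and>
          (\<forall>n \<in> GT k. \<forall>lb. interlaces k lb l \<and> nb \<in> steps (k - 1) lb \<longrightarrow>
             trigV E k l n lb nb = (\<Sum>\<alpha> \<in> I. \<theta> k \<alpha> nb l * trigV (D \<alpha>) k l n lb nb)))"

end

theory Submission
  imports Defs
begin

text \<open>
  For \<open>nb\<close> interlacing with \<open>l\<close>, the coupling condition on a slice is equivalent to the linear system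
  \<open>\<Sum>\<^sub>j V\<^sub>j\<^sub>m T\<^sub>j + W\<^sub>m / a\<^sub>k = S\<^sub>m\<close> for \<open>m \<in> \<F>\<close>, together with two identities that do not involve the
  `dynamics': one making the short-range pushing rule consistent, and one for the diagonal rates.
  Since a `dynamics' is given, both identities hold and need not be proved from the formulas for
  \<open>\<psi>\<close> and \<open>\<psi>'\<close>. Evaluating the second one at the lowest \<open>nb\<close> shows by induction on \<open>k\<close> that \<open>Q\<^sub>k(l, l)\<close>
  is constant, hence \<open>\<Sum> S - \<Sum> T = 1\<close>, which is what the RSK rules need to solve the system.

  A nearest neighbor `dynamics' is determined on a slice by the free parameters
  \<open>V\<^sub>j(\<xi>(j))\<close> and \<open>V\<^sub>j(j + 1)\<close>, which are all zero for PB, while R(h) and L(h) set exactly one of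
  them to 1. So they are the mixing weights of R(j) and L(j), PB receives the rest, and the RSK
  `dynamics' get weight zero.
\<close>

section \<open>Steps and interlacing\<close>

lemma up_inj [simp]: "up i l = up j l \<longleftrightarrow> i = j"
proof
  assume "up i l = up j l"
  from fun_cong[OF this, of i] show "i = j"
    by (simp add: up_def split: if_splits)
qed simp

lemma up_neq [simp]: "up j l \<noteq> l" "l \<noteq> up j l"
  by (auto simp: up_def fun_eq_iff)

lemma down_inj [simp]: "down i l = down j l \<longleftrightarrow> i = j"
proof
  assume "down i l = down j l"
  from fun_cong[OF this, of i] show "i = j"
    by (simp add: down_def split: if_splits)
qed simp

lemma down_neq [simp]: "down j l \<noteq> l" "l \<noteq> down j l"
  by (auto simp: down_def fun_eq_iff)

lemma up_down [simp]: "up j (down j l) = l"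
  by (simp add: up_def down_def)

lemma down_up [simp]: "down j (up j l) = l"
  by (simp add: up_def down_def)

lemma eq_up_iff: "n = up j l \<longleftrightarrow> l = down j n"
  by (metis up_down down_up)

lemma weight_up:
  assumes "j \<in> {1..k}"
  shows "weight k (up j l) = weight k l + 1"
proof -
  have "weight k (up j l) = (\<Sum>i = 1..k. l i + of_bool (i = j))"
    unfolding weight_def by (intro sum.cong) (auto simp: up_def)
  then show ?thesis
    using assms by (simp add: sum.distrib weight_def)
qed

lemma weight_down: "j \<in> {1..k} \<Longrightarrow> weight k (down j l) = weight k l - 1"
  using weight_up[of j k "down j l"] by simp

lemma GT_mono:
  assumes "l \<in> GT k" "1 \<le> i" "i \<le> j" "j \<le> k"
  shows "l j \<le> l i"
  using \<open>i \<le> j\<close> \<open>j \<le> k\<close>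
proof (induction j rule: dec_induct)
  case (step j)
  then have "l (j + 1) \<le> l j"
    using assms by (simp add: GT_def)
  then show ?case
    using step by simp
qed simp

text \<open>The chains \<open>l (i + 1) <= lb i <= l i\<close> and
  \<open>lb (i + 1) <= l (i + 1) <= lb i\<close> already force both sequences to decrease weakly, so
  membership in \<open>GT\<close> reduces to the zero padding.\<close>

lemma interlaces_iff:
  "interlaces k lb l \<longleftrightarrow>
     (\<forall>i. i \<notin> {1..k - 1} \<longrightarrow> lb i = 0) \<and> (\<forall>i. i \<notin> {1..k} \<longrightarrow> l i = 0) \<and>
     (\<forall>i \<in> {1..k - 1}. l (i + 1) \<le> lb i \<and> lb i \<le> l i)" (is "_ \<longleftrightarrow> ?R")
proof
  assume r: ?R
  have "l (i + 1) \<le> l i" if "1 \<le> i" "i < k" for i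
  proof -
    have "l (i + 1) \<le> lb i" "lb i \<le> l i"
      using r that by auto
    then show ?thesis by simp
  qed
  moreover have "lb (i + 1) \<le> lb i" if "1 \<le> i" "i < k - 1" for i
  proof -
    have "lb (i + 1) \<le> l (i + 1)" "l (i + 1) \<le> lb i"
      using r that by auto
    then show ?thesis by simp
  qed
  ultimately show "interlaces k lb l"
    using r by (auto simp: interlaces_def GT_def)
qed (auto simp: interlaces_def GT_def)

lemma finite_interlaces: "finite {lb. interlaces k lb l}"
proof (rule finite_subset)
  show "{lb. interlaces k lb l} \<subseteq>
      {f. \<forall>i. (i \<in> {1..k - 1} \<longrightarrow> f i \<in> (\<Union>j\<in>{1..k - 1}. {l (j + 1)..l j})) \<and>
              (i \<notin> {1..k - 1} \<longrightarrow> f i = 0)}"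
    unfolding interlaces_iff by fastforce
  show "finite \<dots>"
    by (rule finite_set_of_finite_funs) auto
qed

text \<open>Raising \<open>l m\<close> can only break \<open>l m <= nb (m - 1)\<close>, and does not
  do so exactly when this inequality is strict, which is what \<open>Fset\<close> records. An
  \<open>m\<close> outside \<open>{1..k}\<close> fails because the raised entry violates the zero
  padding.\<close>

lemma interlaces_up_iff:
  assumes "interlaces k nb l"
  shows "interlaces k nb (up m l) \<longleftrightarrow> m \<in> Fset k nb l"
proof (cases "m \<in> {1..k}")
  case True
  have "up m l (i + 1) \<le> nb i \<and> nb i \<le> up m l i \<longleftrightarrow> (i + 1 = m \<longrightarrow> l m < nb i)"
    if "i \<in> {1..k - 1}" for i
  proof -
    have "l (i + 1) \<le> nb i \<and> nb i \<le> l i"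
      using assms that by (auto simp: interlaces_iff)
    then show ?thesis
      by (auto simp: up_def)
  qed
  moreover have "\<forall>i. i \<notin> {1..k} \<longrightarrow> up m l i = 0" "\<forall>i. i \<notin> {1..k - 1} \<longrightarrow> nb i = 0"
    using assms True by (auto simp: interlaces_iff up_def)
  ultimately have "interlaces k nb (up m l) \<longleftrightarrow> (\<forall>i \<in> {1..k - 1}. i + 1 = m \<longrightarrow> l m < nb i)"
    unfolding interlaces_iff by blast
  also have "\<dots> \<longleftrightarrow> m \<in> Fset k nb l"
    using True by (cases m) (auto simp: Fset_def)
  finally show ?thesis .
next
  case False
  then have "l m = 0"
    using assms unfolding interlaces_iff by blast
  then have "up m l m \<noteq> 0"
    by (simp add: up_def)
  then show ?thesis
    using False by (auto simp: interlaces_iff Fset_def)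
qed

text \<open>The lower coordinates that can have jumped last: \<open>down j nb\<close> still
  interlaces with \<open>l\<close>. Indeed \<open>j + 1 \<in> Fset k nb l\<close> unfolds to
  \<open>l (j + 1) < nb j\<close>.\<close>

definition moves :: "nat \<Rightarrow> signature \<Rightarrow> signature \<Rightarrow> nat set" where
  "moves k nb l = {j \<in> {1..k - 1}. j + 1 \<in> Fset k nb l}"

lemma interlaces_down_iff:
  assumes "interlaces k nb l"
  shows "interlaces k (down j nb) l \<longleftrightarrow> j \<in> moves k nb l"
proof (cases "j \<in> {1..k - 1}")
  case True
  have "l (i + 1) \<le> down j nb i \<and> down j nb i \<le> l i \<longleftrightarrow> (i = j \<longrightarrow> l (j + 1) < nb j)"
    if "i \<in> {1..k - 1}" for i
  proof -
    have "l (i + 1) \<le> nb i \<and> nb i \<le> l i"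
      using assms that by (auto simp: interlaces_iff)
    then show ?thesis
      by (auto simp: down_def)
  qed
  moreover have "\<forall>i. i \<notin> {1..k} \<longrightarrow> l i = 0" "\<forall>i. i \<notin> {1..k - 1} \<longrightarrow> down j nb i = 0"
    using assms True by (auto simp: interlaces_iff down_def)
  ultimately have "interlaces k (down j nb) l \<longleftrightarrow> l (j + 1) < nb j"
    unfolding interlaces_iff using True by blast
  also have "\<dots> \<longleftrightarrow> j \<in> moves k nb l"
    using True by (auto simp: moves_def Fset_def)
  finally show ?thesis .
next
  case False
  then have "nb j = 0"
    using assms unfolding interlaces_iff by blast
  then have "down j nb j \<noteq> 0"
    by (simp add: down_def)
  then show ?thesis
    using False by (auto simp: interlaces_iff moves_def)
qed

lemma finite_Fset [simp]: "finite (Fset k nb l)"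
  by (simp add: Fset_def)

lemma finite_moves [simp]: "finite (moves k nb l)"
  by (simp add: moves_def)

lemma steps_minus: "l \<in> GT k \<Longrightarrow> steps k l - {l} = (\<lambda>m. up m l) ` {m \<in> {1..k}. up m l \<in> GT k}"
  by (auto simp: steps_def)

lemma finite_steps [simp]: "finite (steps k l)"
  by (rule finite_subset[of _ "insert l ((\<lambda>m. up m l) ` {1..k})"]) (auto simp: steps_def)

text \<open>Rates and triggered probabilities vanish at targets not interlacing with
  \<open>nb\<close>, so their sum rules become sums over \<open>Fset\<close>.\<close>

lemma sum_steps:
  fixes g :: "signature \<Rightarrow> real"
  assumes "interlaces k nb l" and "\<And>n. n \<in> GT k \<Longrightarrow> \<not> interlaces k nb n \<Longrightarrow> g n = 0"
  shows "sum g (steps k l - {l}) = (\<Sum>m \<in> Fset k nb l. g (up m l))"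
proof -
  have l: "l \<in> GT k"
    using assms by (simp add: interlaces_def)
  have "sum g (steps k l - {l}) = (\<Sum>m | m \<in> {1..k} \<and> up m l \<in> GT k. g (up m l))"
    unfolding steps_minus[OF l] by (subst sum.reindex) (auto intro: inj_onI)
  also have "\<dots> = (\<Sum>m \<in> Fset k nb l. g (up m l))"
  proof (intro sum.mono_neutral_right)
    show "Fset k nb l \<subseteq> {m \<in> {1..k}. up m l \<in> GT k}"
      using interlaces_up_iff[OF assms(1)] by (auto simp: interlaces_def Fset_def)
    show "\<forall>m \<in> {m \<in> {1..k}. up m l \<in> GT k} - Fset k nb l. g (up m l) = 0"
      using interlaces_up_iff[OF assms(1)] assms(2) by blast
  qed auto
  finally show ?thesis .
qed

lemma sum_steps':
  fixes g :: "signature \<Rightarrow> real"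
  assumes "interlaces k nb l" and "\<And>n. n \<in> GT k \<Longrightarrow> \<not> interlaces k nb n \<Longrightarrow> g n = 0"
  shows "sum g (steps k l) = g l + (\<Sum>m \<in> Fset k nb l. g (up m l))"
proof -
  have "l \<in> steps k l"
    using assms by (simp add: interlaces_def steps_def)
  then show ?thesis
    using sum_steps[OF assms] by (simp add: sum.remove)
qed

text \<open>The only inequality that the jump of \<open>lb j\<close> can break is
  \<open>lb j <= l j\<close>, hence \<open>lb j = l j\<close>. Interlacing is then restored only by
  a step that raises \<open>l j\<close> itself.\<close>

lemma interlaces_short_range:
  assumes "interlaces k lb l" "j \<in> {1..k - 1}" "up j lb \<in> GT (k - 1)"
    and "\<not> interlaces k (up j lb) l"
  shows "interlaces k (up j lb) (up j l)"
    and "n \<in> steps k l \<Longrightarrow> interlaces k (up j lb) n \<Longrightarrow> n = up j l"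
proof -
  have lbj: "lb j = l j"
  proof (rule ccontr)
    assume "lb j \<noteq> l j"
    then have "l (i + 1) \<le> up j lb i \<and> up j lb i \<le> l i" if "i \<in> {1..k - 1}" for i
    proof -
      have "l (i + 1) \<le> lb i \<and> lb i \<le> l i"
        using assms that by (auto simp: interlaces_iff)
      then show ?thesis
        using \<open>lb j \<noteq> l j\<close> by (auto simp: up_def)
    qed
    then have "interlaces k (up j lb) l"
      using assms by (auto simp: interlaces_iff up_def)
    with assms show False by simp
  qed
  have "up j l (i + 1) \<le> up j lb i" if "i \<in> {1..k - 1}" for i
  proof (cases "i + 1 = j")
    case True
    \<comment> \<open>Room for the upper jump: since \<open>up j lb\<close> is a signature,
      \<open>lb j < lb (j - 1)\<close>, and \<open>lb j = l j\<close>.\<close>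
    then have "up j lb (i + 1) \<le> up j lb i"
      using assms that by (auto simp: GT_def)
    then show ?thesis
      using True lbj by (auto simp: up_def)
  next
    case False
    then have "l (i + 1) \<le> lb i"
      using assms that by (auto simp: interlaces_iff)
    then show ?thesis
      using False by (auto simp: up_def)
  qed
  moreover have "up j lb i \<le> up j l i" if "i \<in> {1..k - 1}" for i
    using assms that by (auto simp: interlaces_iff up_def)
  ultimately show "interlaces k (up j lb) (up j l)"
    using assms by (auto simp: interlaces_iff up_def)
  assume n: "n \<in> steps k l" "interlaces k (up j lb) n"
  then have "up j lb j \<le> n j"
    using assms by (auto simp: interlaces_iff)
  then show "n = up j l"
    using n lbj by (auto simp: steps_def up_def split: if_splits)
qed

text \<open>The same situation seen from its target: the violated inequality must be
  \<open>nb m <= l m\<close>, so \<open>nb m = l m + 1\<close>. Any predecessor of \<open>nb\<close>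
  interlacing with \<open>l\<close> must lower exactly this coordinate.\<close>

lemma interlaces_up_cases:
  assumes "interlaces k nb (up m l)" "l \<in> GT k" "m \<in> {1..k}" "\<not> interlaces k nb l"
  shows "m \<in> {1..k - 1}" and "interlaces k (down m nb) l"
    and "j \<in> {1..k - 1} \<Longrightarrow> interlaces k (down j nb) l \<Longrightarrow> j = m"
proof -
  have *: "m \<in> {1..k - 1} \<and> l m < nb m"
  proof (rule ccontr)
    assume c: "\<not> ?thesis"
    have "l (i + 1) \<le> nb i \<and> nb i \<le> l i" if "i \<in> {1..k - 1}" for i
    proof -
      have "up m l (i + 1) \<le> nb i \<and> nb i \<le> up m l i"
        using assms that by (auto simp: interlaces_iff)
      then show ?thesis
        using c that by (auto simp: up_def split: if_splits)
    qed
    then have "interlaces k nb l"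
      using assms by (auto simp: interlaces_iff GT_def)
    with assms show False by simp
  qed
  then show m: "m \<in> {1..k - 1}" by simp
  have "l (i + 1) \<le> down m nb i \<and> down m nb i \<le> l i" if "i \<in> {1..k - 1}" for i
  proof -
    have "up m l (i + 1) \<le> nb i \<and> nb i \<le> up m l i"
      using assms that by (auto simp: interlaces_iff)
    moreover have "l (m + 1) \<le> l m"
      using assms m by (auto simp: GT_def)
    ultimately show ?thesis
      using * that by (auto simp: up_def down_def split: if_splits)
  qed
  then show "interlaces k (down m nb) l"
    using assms m by (auto simp: interlaces_iff GT_def down_def)
  assume j: "j \<in> {1..k - 1}" "interlaces k (down j nb) l"
  then have "down j nb m \<le> l m"
    using m by (auto simp: interlaces_iff)
  then show "j = m"
    using * by (auto simp: down_def split: if_splits)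
qed

section \<open>Positivity of the Macdonald quantities\<close>

text \<open>All factors are positive and their distances to 1 form a convergent geometric series, so
  the product converges to a nonzero limit.\<close>

lemma qpoch_inf_pos:
  assumes "0 \<le> x" "x < 1" "0 \<le> q" "q < 1"
  shows "qpoch_inf x q > 0"
proof -
  have pos: "1 - x * q ^ i > 0" for i
    using mult_le_one[of x "q ^ i"] assms power_le_one[of q i]
    by (smt (verit) mult_left_le zero_le_power)
  have "summable (\<lambda>i. x * q ^ i)"
    using assms by (intro summable_mult summable_geometric) auto
  then have "summable (\<lambda>i. norm (1 - x * q ^ i - 1))"
    using assms by simp
  then have "convergent_prod (\<lambda>i. 1 - x * q ^ i)"
    by (intro abs_convergent_prod_imp_convergent_prod summable_imp_abs_convergent_prod)
  then have "(\<lambda>i. 1 - x * q ^ i) has_prod qpoch_inf x q"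
    unfolding qpoch_inf_def by (rule convergent_prod_has_prod)
  then show ?thesis
    using pos by (rule has_prod_pos)
qed

lemma mac_f_pos:
  assumes "0 \<le> q" "q < 1" "0 \<le> t" "t < 1" "0 \<le> u" "u \<le> 1"
  shows "mac_f q t u > 0"
  unfolding mac_f_def using assms
  by (intro divide_pos_pos qpoch_inf_pos) (auto intro: le_less_trans[OF mult_left_le])

lemma powi_le_one:
  fixes q :: real
  assumes "0 \<le> q" "q \<le> 1" "0 \<le> d"
  shows "q powi d \<le> 1"
  using assms by (simp add: power_int_def power_le_one)

lemma mac_f_powi_pos:
  assumes "0 \<le> q" "q < 1" "0 \<le> t" "t < 1" "0 \<le> d"
  shows "mac_f q t (q powi d * t ^ n) > 0"
  using assms by (intro mac_f_pos mult_le_one powi_le_one) (auto simp: power_le_one)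

text \<open>Interlacing makes all four exponents of \<open>q\<close> nonnegative, so
  \<open>mac_f\<close> is only evaluated at points of \<open>[0,1]\<close>.\<close>

lemma psi_pos:
  assumes "0 \<le> q" "q < 1" "0 \<le> t" "t < 1" "interlaces m kp n"
  shows "psi q t m n kp > 0"
proof -
  have GT: "kp \<in> GT (m - 1)" "n \<in> GT m"
    using assms by (auto simp: interlaces_def)
  have le: "kp j \<le> kp i" "n (j + 1) \<le> n i" "kp j \<le> n i" "n (j + 1) \<le> kp i"
    if "1 \<le> i" "i \<le> j" "j \<le> m - 1" for i j
  proof -
    show 1: "kp j \<le> kp i" "n (j + 1) \<le> n i"
      using that GT by (auto intro: GT_mono)
    have "n (j + 1) \<le> kp j" "kp i \<le> n i"
      using that assms by (auto simp: interlaces_iff)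
    then show "kp j \<le> n i" "n (j + 1) \<le> kp i"
      using 1 by auto
  qed
  show ?thesis
    unfolding psi_def using assms le
    by (auto intro!: prod_pos divide_pos_pos mult_pos_pos mac_f_powi_pos)
qed

lemma one_minus_powi_pos:
  fixes q t :: real
  assumes "0 \<le> q" "q < 1" "0 \<le> t" "t < 1" "0 \<le> d" "d \<noteq> 0 \<or> n \<noteq> 0"
  shows "1 - q powi d * t ^ n > 0"
proof (cases "d = 0")
  case True
  then show ?thesis
    using assms by (simp add: power_less_one_iff)
next
  case False
  then have "q powi d < 1"
    using assms by (simp add: power_int_def power_less_one_iff)
  moreover have "q powi d * t ^ n \<le> q powi d"
    using assms by (intro mult_left_le) (auto simp: power_le_one)
  ultimately show ?thesis by simp
qed

text \<open>As \<open>up j m\<close> is a signature, \<open>m i - m j >= 1\<close> for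
  \<open>i < j\<close>. Hence no factor degenerates to \<open>1 - q^0 * t^0\<close>: the power
  \<open>t ^ (j - i - 1)\<close>, which may be \<open>t^0\<close>, comes with the exponent
  \<open>m i - m j\<close> of \<open>q\<close>, and the other powers of \<open>t\<close> have
  positive exponent.\<close>

lemma psi'_pos:
  assumes "0 \<le> q" "q < 1" "0 \<le> t" "t < 1" "m \<in> GT k" "up j m \<in> GT k" "j \<le> k"
  shows "psi' q t k j m > 0"
proof -
  have "m j + 1 \<le> m i" if "i \<in> {1..<j}" for i
    using GT_mono[OF assms(6), of i j] that assms by (auto simp: up_def)
  then have "((1 - q powi (m i - m j) * t ^ (j - i - 1)) *
      (1 - q powi (m i - m j - 1) * t ^ (j - i + 1))) /
      ((1 - q powi (m i - m j) * t ^ (j - i)) *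
      (1 - q powi (m i - m j - 1) * t ^ (j - i))) > 0" if "i \<in> {1..<j}" for i
    using assms(1-4) that
    by (intro divide_pos_pos mult_pos_pos one_minus_powi_pos) force+
  then show ?thesis
    unfolding psi'_def using assms by (auto intro!: prod_pos simp del: zero_less_divide_iff)
qed

text \<open>Every coordinate sits at its lower bound, so none can be lowered and only
  \<open>l 1\<close> can be raised. This leaves a single computable term in the diagonal
  identity.\<close>

definition lowest :: "nat \<Rightarrow> signature \<Rightarrow> signature" where
  "lowest k l = (\<lambda>i. if i \<in> {1..k - 1} then l (i + 1) else 0)"

lemma interlaces_lowest: "l \<in> GT k \<Longrightarrow> interlaces k (lowest k l) l"
  by (auto simp: interlaces_iff lowest_def GT_def)

lemma Fset_lowest: "k \<ge> 1 \<Longrightarrow> Fset k (lowest k l) l = {1}"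
  by (auto simp: Fset_def lowest_def)

text \<open>With \<open>kp i = n (i + 1)\<close> the numerator and the denominator of each factor
  are the same product. Letting \<open>n\<close> differ from \<open>l\<close> in the first
  coordinate covers both \<open>l\<close> and \<open>up 1 l\<close>.\<close>

lemma psi_lowest:
  assumes "0 \<le> q" "q < 1" "0 \<le> t" "t < 1" "interlaces k (lowest k l) n"
    and "\<And>i. i \<ge> 2 \<Longrightarrow> n i = l i"
  shows "psi q t k n (lowest k l) = 1"
proof -
  have "(mac_f q t (q powi (lowest k l i - lowest k l j) * t ^ (j - i)) *
           mac_f q t (q powi (n i - n (j + 1)) * t ^ (j - i))) /
          (mac_f q t (q powi (n i - lowest k l j) * t ^ (j - i)) *
           mac_f q t (q powi (lowest k l i - n (j + 1)) * t ^ (j - i))) = 1"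
    if "1 \<le> i" "i \<le> j" "j \<le> k - 1" for i j
  proof -
    have e: "lowest k l j = n (j + 1)" "lowest k l i = n (i + 1)"
      using that assms by (auto simp: lowest_def)
    have n: "n \<in> GT k"
      using assms by (simp add: interlaces_def)
    have "n (j + 1) \<le> n (i + 1)" "n (j + 1) \<le> n i"
      using GT_mono[OF n, of "i + 1" "j + 1"] GT_mono[OF n, of i "j + 1"] that by auto
    then have "mac_f q t (q powi (n (i + 1) - n (j + 1)) * t ^ (j - i)) > 0"
      "mac_f q t (q powi (n i - n (j + 1)) * t ^ (j - i)) > 0"
      using assms by (auto intro!: mac_f_powi_pos)
    then show ?thesis
      unfolding e by auto
  qed
  then show ?thesis
    unfolding psi_def if_P[OF assms(5)]
    by (intro prod.neutral) (auto simp only: mem_Collect_eq prod.case)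
qed

section \<open>Interlacing arrays and positivity of Macdonald polynomials\<close>

lemma GT_0 [simp]: "GT 0 = {\<lambda>_. 0}"
  by (auto simp: GT_def)

lemma arrays_0 [simp]: "arrays 0 (\<lambda>_. 0) = {\<lambda>_ _. 0}"
  by (auto simp: arrays_def fun_eq_iff) (metis not_gr_zero)

lemma arrays_Suc:
  "arrays (Suc k) l = (\<lambda>A. A(Suc k := l)) ` (\<Union>lb \<in> {lb. interlaces (Suc k) lb l}. arrays k lb)"
proof (intro equalityI subsetI)
  fix A assume A: "A \<in> arrays (Suc k) l"
  then have "A(Suc k := (\<lambda>_. 0)) \<in> arrays k (A k)"
    by (auto simp: arrays_def)
  moreover have "interlaces (Suc k) (A k) l"
    using A by (auto simp: arrays_def dest: bspec[of _ _ "Suc k"])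
  moreover have "A = (A(Suc k := (\<lambda>_. 0)))(Suc k := l)"
    using A by (auto simp: arrays_def)
  ultimately show "A \<in> (\<lambda>A. A(Suc k := l)) ` (\<Union>lb \<in> {lb. interlaces (Suc k) lb l}. arrays k lb)"
    by blast
qed (auto simp: arrays_def le_Suc_eq)

lemma finite_arrays: "finite (arrays k l)"
proof (induction k arbitrary: l)
  case 0
  have "arrays 0 l \<subseteq> {\<lambda>_ _. 0}"
    by (auto simp: arrays_def fun_eq_iff) (metis not_gr_zero)
  then show ?case
    by (rule finite_subset) simp
next
  case (Suc k)
  then show ?case
    by (simp add: arrays_Suc finite_interlaces)
qed

text \<open>Strict positivity of \<open>mac_P\<close> needs at least one array; taking the lowest
  row repeatedly produces one.\<close>

lemma arrays_nonempty: "l \<in> GT k \<Longrightarrow> arrays k l \<noteq> {}"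
proof (induction k arbitrary: l)
  case (Suc k)
  have "interlaces (Suc k) (lowest (Suc k) l) l"
    using Suc.prems by (rule interlaces_lowest)
  moreover from this have "arrays k (lowest (Suc k) l) \<noteq> {}"
    by (intro Suc.IH) (simp add: interlaces_def)
  ultimately show ?case
    by (auto simp: arrays_Suc)
qed auto

lemma mac_P_pos:
  assumes "0 \<le> q" "q < 1" "0 \<le> t" "t < 1" "l \<in> GT k" "\<And>i. i \<in> {1..k} \<Longrightarrow> a i > 0"
  shows "mac_P q t a k l > 0"
  unfolding mac_P_def using assms
  by (intro sum_pos finite_arrays arrays_nonempty prod_pos ballI mult_pos_pos psi_pos)
     (auto simp: arrays_def)

lemma mac_P_1:
  assumes "l \<in> GT 1"
  shows "mac_P q t a 1 l = a 1 powi l 1"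
proof -
  have i: "interlaces (Suc 0) lb l \<longleftrightarrow> lb = (\<lambda>_. 0)" for lb
    using assms by (auto simp: interlaces_def)
  have "arrays 1 l = {(\<lambda>_ _. 0)(1 := l)}"
    by (simp add: arrays_Suc i fun_upd_def)
  moreover have "psi q t 1 l (\<lambda>_. 0) = 1"
    by (auto simp: psi_def i intro!: prod.neutral)
  ultimately show ?thesis
    by (simp add: mac_P_def weight_def fun_upd_def)
qed

section \<open>Balance equations on a slice\<close>

text \<open>This and \<open>trigV_rules\<close> are the clauses of \<open>dynamics\<close> other
  than \<open>consistent\<close>, isolated level by level because the coupling condition is analysed
  on one slice at a time.\<close>

definition rateW_rules :: "nat \<Rightarrow> mdyn \<Rightarrow> bool" where
  "rateW_rules k D \<longleftrightarrow> (\<forall>l lb. interlaces k lb l \<longrightarrow>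
     (\<forall>n \<in> GT k. n \<notin> steps k l \<or> \<not> interlaces k lb n \<longrightarrow> rateW D k l n lb = 0) \<and>
     (\<Sum>n \<in> steps k l - {l}. rateW D k l n lb) = - rateW D k l l lb)"

definition trigV_rules :: "nat \<Rightarrow> mdyn \<Rightarrow> bool" where
  "trigV_rules k D \<longleftrightarrow> (\<forall>l lb. \<forall>nb \<in> steps (k - 1) lb. interlaces k lb l \<longrightarrow>
     (\<forall>n \<in> GT k. n \<notin> steps k l \<or> \<not> interlaces k nb n \<longrightarrow> trigV D k l n lb nb = 0) \<and>
     (\<Sum>n \<in> steps k l. trigV D k l n lb nb) = 1 \<and>
     (\<forall>n \<in> GT k. trigV D k l n lb lb = of_bool (l = n)))"

lemma dynamics_iff:
  "dynamics q t a N D \<longleftrightarrow> (\<forall>k \<in> {1..N}. rateW_rules k D) \<and> (\<forall>k \<in> {2..N}. trigV_rules k D) \<and>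
     (\<forall>k \<in> {1..N}. consistent q t a k D)"
  unfolding dynamics_def rateW_rules_def trigV_rules_def by blast

lemma rateW_diag:
  assumes "rateW_rules k D" "interlaces k nb l"
  shows "rateW D k l l nb = - (\<Sum>m \<in> Fset k nb l. rateW D k l (up m l) nb)"
  using assms sum_steps[of k nb l "\<lambda>n. rateW D k l n nb"] by (auto simp: rateW_rules_def)

lemma down_in_steps:
  assumes "interlaces k (down j nb) l" "j \<in> {1..k - 1}" "nb \<in> GT (k - 1)"
  shows "nb \<in> steps (k - 1) (down j nb)"
  using assms by (auto simp: steps_def eq_up_iff)

lemma trigV_diag:
  assumes "trigV_rules k D" "interlaces k nb l" "j \<in> moves k nb l"
  shows "trigV D k l l (down j nb) nb =
    1 - (\<Sum>m \<in> Fset k nb l. trigV D k l (up m l) (down j nb) nb)"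
proof -
  have lb: "interlaces k (down j nb) l"
    using assms by (simp add: interlaces_down_iff)
  have "nb \<in> steps (k - 1) (down j nb)"
    using assms lb by (intro down_in_steps) (auto simp: moves_def interlaces_def)
  then show ?thesis
    using assms lb sum_steps'[of k nb l "\<lambda>n. trigV D k l n (down j nb) nb"]
    by (auto simp: trigV_rules_def)
qed

text \<open>Among the steps from \<open>l\<close> only \<open>up j l\<close> interlaces with the new
  lower signature, so normalization puts all the probability there.\<close>

lemma trigV_short_range:
  assumes "trigV_rules k D" "interlaces k lb l" "j \<in> {1..k - 1}" "up j lb \<in> GT (k - 1)"
    and "\<not> interlaces k (up j lb) l"
  shows "trigV D k l (up j l) lb (up j lb) = 1"
proof -
  note sr = interlaces_short_range[OF assms(2-5)]
  have nb: "up j lb \<in> steps (k - 1) lb"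
    using assms by (auto simp: steps_def)
  have up: "up j l \<in> steps k l"
    using sr(1) assms(3) by (auto simp: steps_def interlaces_def)
  have "(\<Sum>n \<in> steps k l. trigV D k l n lb (up j lb)) =
      (\<Sum>n \<in> {up j l}. trigV D k l n lb (up j lb))"
  proof (intro sum.mono_neutral_right)
    show "\<forall>n \<in> steps k l - {up j l}. trigV D k l n lb (up j lb) = 0"
    proof
      fix n assume n: "n \<in> steps k l - {up j l}"
      then have "n \<in> GT k" "\<not> interlaces k (up j lb) n"
        using sr(2) by (auto simp: steps_def)
      then show "trigV D k l n lb (up j lb) = 0"
        using assms(1,2) nb by (simp add: trigV_rules_def)
    qed
  qed (use up in auto)
  moreover have "(\<Sum>n \<in> steps k l. trigV D k l n lb (up j lb)) = 1"
    using assms(1,2) nb by (simp add: trigV_rules_def)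
  ultimately show ?thesis by simp
qed

section \<open>Nonvanishing coefficients and sums against the links\<close>

locale macdonald =
  fixes q t :: real and a :: "nat \<Rightarrow> real" and N :: nat
  assumes q: "0 \<le> q" "q < 1" and t: "0 \<le> t" "t < 1" and a_pos: "\<And>k. k \<in> {1..N} \<Longrightarrow> a k > 0"
begin

abbreviation "P \<equiv> mac_P q t a"
abbreviation "Q \<equiv> uni_rate q t a"
abbreviation "T \<equiv> T_coef q t"
abbreviation "S \<equiv> S_coef q t"

lemma P_pos: "l \<in> GT k \<Longrightarrow> k \<le> N \<Longrightarrow> P k l > 0"
  using q t by (intro mac_P_pos a_pos) auto

lemma psi_pos': "interlaces k nb l \<Longrightarrow> psi q t k l nb > 0"
  using q t by (rule psi_pos)

text \<open>The RSK rule divides by \<open>T k nb l j\<close>.\<close>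

lemma T_nonzero:
  assumes "interlaces k nb l" "j \<in> moves k nb l"
  shows "T k nb l j \<noteq> 0"
proof -
  have i: "interlaces k (down j nb) l"
    using assms by (simp add: interlaces_down_iff)
  then have "psi' q t (k - 1) j (down j nb) > 0"
    using assms q t by (intro psi'_pos) (auto simp: interlaces_def moves_def)
  then show ?thesis
    using psi_pos'[OF i] psi_pos'[OF assms(1)] by (simp add: T_coef_def)
qed

lemma T_zero: "interlaces k nb l \<Longrightarrow> j \<notin> moves k nb l \<Longrightarrow> T k nb l j = 0"
  using interlaces_down_iff[of k nb l j] by (simp add: T_coef_def psi_def)

lemma S_zero: "interlaces k nb l \<Longrightarrow> m \<notin> Fset k nb l \<Longrightarrow> S k nb l m = 0"
  using interlaces_up_iff[of k nb l m] by (simp add: S_coef_def psi_def)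

lemma offdiag_rate_eq:
  "offdiag_rate q t a k l n =
     (\<Sum>j \<in> {1..k}. of_bool (l = down j n) * (P k n / P k l * psi' q t k j l))"
  unfolding offdiag_rate_def eq_up_iff
  by (rule sum.mono_neutral_cong_left) auto

lemma Q_up: "m \<in> {1..k} \<Longrightarrow> Q k l (up m l) = P k (up m l) / P k l * psi' q t k m l"
  by (simp add: uni_rate_def offdiag_rate_def conj_commute cong: conj_cong)

lemma Q_zero: "n \<in> GT k \<Longrightarrow> n \<notin> steps k l \<Longrightarrow> l \<in> GT k \<Longrightarrow> Q k l n = 0"
  by (auto simp: uni_rate_def offdiag_rate_def steps_def intro!: sum.neutral)

text \<open>The rate into \<open>nb\<close> is nonzero only from \<open>nb\<close> itself and from
  the \<open>down j nb\<close>. For the latter, \<open>P (k - 1) lb\<close> cancels between link and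
  rate. Predecessors that do not interlace with \<open>l\<close> may stay in the sum because their
  \<open>psi\<close> is 0.\<close>

lemma sum_link_rate:
  assumes k: "k \<in> {2..N}" and l: "l \<in> GT k" and nb: "nb \<in> GT (k - 1)"
  shows "(\<Sum>lb | interlaces k lb l. g lb * link q t a k l lb * Q (k - 1) lb nb) =
     g nb * link q t a k l nb * Q (k - 1) nb nb +
     (\<Sum>j \<in> {1..k - 1}. g (down j nb) *
        (P (k - 1) nb / P k l * psi q t k l (down j nb) * psi' q t (k - 1) j (down j nb) *
         a k powi (weight k l - weight (k - 1) nb + 1)))"
proof -
  let ?I = "{lb. interlaces k lb l}"
  define X where "X j = P (k - 1) nb / P k l * psi q t k l (down j nb) *
      psi' q t (k - 1) j (down j nb) * a k powi (weight k l - weight (k - 1) nb + 1)" for j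
  have "link q t a k l lb * Q (k - 1) lb nb =
      of_bool (lb = nb) * (link q t a k l nb * Q (k - 1) nb nb) +
      (\<Sum>j \<in> {1..k - 1}. of_bool (lb = down j nb) * X j)" if lb: "interlaces k lb l" for lb
  proof (cases "lb = nb")
    case True
    then show ?thesis by simp
  next
    case False
    have "P (k - 1) lb > 0"
      using lb k by (intro P_pos) (auto simp: interlaces_def)
    then have "link q t a k l lb * (of_bool (lb = down j nb) *
        (P (k - 1) nb / P (k - 1) lb * psi' q t (k - 1) j lb)) =
        of_bool (lb = down j nb) * X j" if "j \<in> {1..k - 1}" for j
    proof (cases "lb = down j nb")
      case True
      have w: "weight k l - weight (k - 1) nb + 1 = weight k l - weight (k - 1) lb"
        using weight_down[OF that, of nb] True by simp
      show ?thesis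
        unfolding X_def w using k \<open>P (k - 1) lb > 0\<close> True by (simp add: link_def)
    qed simp
    then show ?thesis
      using False by (simp add: uni_rate_def offdiag_rate_eq sum_distrib_left del: atLeastAtMost_iff)
  qed
  then have "(\<Sum>lb \<in> ?I. g lb * link q t a k l lb * Q (k - 1) lb nb) =
      (\<Sum>lb \<in> ?I. g lb * (of_bool (lb = nb) * (link q t a k l nb * Q (k - 1) nb nb) +
      (\<Sum>j \<in> {1..k - 1}. of_bool (lb = down j nb) * X j)))"
    by (simp add: mult.assoc)
  also have "\<dots> = (\<Sum>lb \<in> ?I. if lb = nb then g nb * link q t a k l nb * Q (k - 1) nb nb else 0) +
      (\<Sum>lb \<in> ?I. \<Sum>j \<in> {1..k - 1}. if lb = down j nb then g (down j nb) * X j else 0)"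
    unfolding sum.distrib[symmetric] distrib_left sum_distrib_left
    by (intro sum.cong refl arg_cong2[where f = "(+)"]) auto
  also have "(\<Sum>lb \<in> ?I. \<Sum>j \<in> {1..k - 1}. if lb = down j nb then g (down j nb) * X j else 0) =
      (\<Sum>j \<in> {1..k - 1}. if interlaces k (down j nb) l then g (down j nb) * X j else 0)"
    by (subst sum.swap) (simp add: finite_interlaces)
  also have "\<dots> = (\<Sum>j \<in> {1..k - 1}. g (down j nb) * X j)"
    by (intro sum.cong refl) (auto simp: X_def psi_def)
  also have "(\<Sum>lb \<in> ?I. if lb = nb then g nb * link q t a k l nb * Q (k - 1) nb nb else 0) =
      g nb * link q t a k l nb * Q (k - 1) nb nb"
    using k by (auto simp: finite_interlaces link_def psi_def)
  finally show ?thesis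
    unfolding X_def .
qed

section \<open>The three pieces of the coupling condition\<close>

definition consistent_at :: "nat \<Rightarrow> mdyn \<Rightarrow> signature \<Rightarrow> signature \<Rightarrow> signature \<Rightarrow> bool" where
  "consistent_at k D l n nb \<longleftrightarrow>
     (\<Sum>lb | interlaces k lb l. trigV D k l n lb nb * link q t a k l lb * Q (k - 1) lb nb)
        + rateW D k l n nb * link q t a k l nb = Q k l n * link q t a k n nb"

text \<open>The coupling condition for the jump to \<open>up m l\<close> with \<open>nb\<close>
  interlacing with \<open>l\<close>, divided by \<open>a k * link q t a k l nb\<close>.\<close>

definition balanced :: "nat \<Rightarrow> mdyn \<Rightarrow> bool" where
  "balanced k D \<longleftrightarrow> (\<forall>l nb. interlaces k nb l \<longrightarrow> (\<forall>m \<in> Fset k nb l.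
     (\<Sum>j \<in> moves k nb l. trigV D k l (up m l) (down j nb) nb * T k nb l j)
       + rateW D k l (up m l) nb / a k = S k nb l m))"

text \<open>What the coupling condition becomes when the jump is forced by short-range
  pushing.\<close>

definition short_range_identity :: "nat \<Rightarrow> bool" where
  "short_range_identity k \<longleftrightarrow> (\<forall>l \<in> GT k. \<forall>m \<in> {1..k}. \<forall>nb.
     interlaces k nb (up m l) \<and> \<not> interlaces k nb l \<longrightarrow>
     psi q t k l (down m nb) * psi' q t (k - 1) m (down m nb) =
     psi' q t k m l * psi q t k (up m l) nb)"

text \<open>The coupling condition at \<open>n = l\<close> after the diagonal values of
  \<open>V\<close> and \<open>W\<close> have been eliminated.\<close>

definition diagonal_identity :: "nat \<Rightarrow> bool" where
  "diagonal_identity k \<longleftrightarrow> (\<forall>l nb. interlaces k nb l \<longrightarrow>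
     Q k l l - Q (k - 1) nb nb =
     a k * ((\<Sum>j \<in> moves k nb l. T k nb l j) - (\<Sum>m \<in> Fset k nb l. S k nb l m)))"

text \<open>Both sides are 0: where the rules do not force \<open>V\<close> or \<open>W\<close> to
  vanish, the univariate rate or the link does.\<close>

lemma consistent_at_no_step:
  assumes "k \<in> {2..N}" "rateW_rules k D" "trigV_rules k D" "l \<in> GT k" "n \<in> GT k" "n \<notin> steps k l"
    and "nb \<in> GT (k - 1)"
  shows "consistent_at k D l n nb"
proof -
  have "trigV D k l n lb nb * link q t a k l lb * Q (k - 1) lb nb = 0" if lb: "interlaces k lb l" for lb
  proof (cases "nb \<in> steps (k - 1) lb")
    case True
    then show ?thesis
      using assms lb by (auto simp: trigV_rules_def)
  next
    case False
    then have "Q (k - 1) lb nb = 0"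
      using lb assms by (auto intro: Q_zero simp: interlaces_def)
    then show ?thesis by simp
  qed
  moreover have "rateW D k l n nb * link q t a k l nb = 0"
    using assms by (cases "interlaces k nb l") (auto simp: rateW_rules_def link_def psi_def)
  moreover have "Q k l n = 0"
    using assms by (auto intro: Q_zero)
  ultimately show ?thesis
    by (simp add: consistent_at_def sum.neutral)
qed

section \<open>The coupling condition of one collection on one slice\<close>

context
  fixes k :: nat and D :: mdyn
  assumes k: "k \<in> {2..N}" and W: "rateW_rules k D" and V: "trigV_rules k D"
begin

text \<open>Relative to \<open>link q t a k l nb\<close>, the term of \<open>down j nb\<close>
  carries a ratio of \<open>psi\<close> values, a factor \<open>psi'\<close> and one more power of
  \<open>a k\<close>, from the smaller lower weight. Together these are
  \<open>a k * T k nb l j\<close>.\<close>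

lemma sum_flow_interlaced:
  assumes "interlaces k nb l"
  shows "(\<Sum>lb | interlaces k lb l. trigV D k l n lb nb * link q t a k l lb * Q (k - 1) lb nb) =
     link q t a k l nb * (trigV D k l n nb nb * Q (k - 1) nb nb +
       a k * (\<Sum>j \<in> moves k nb l. trigV D k l n (down j nb) nb * T k nb l j))"
proof -
  have psi: "psi q t k l nb \<noteq> 0"
    using psi_pos'[OF assms] by simp
  have a: "a k \<noteq> 0"
    using a_pos[of k] k by simp
  have GT: "l \<in> GT k" "nb \<in> GT (k - 1)"
    using assms by (auto simp: interlaces_def)
  have pow: "a k powi (weight k l - weight (k - 1) nb + 1) =
      a k powi (weight k l - weight (k - 1) nb) * a k"
    using a by (rule power_int_add_1[OF disjI1])
  have X: "trigV D k l n (down j nb) nb *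
        (P (k - 1) nb / P k l * psi q t k l (down j nb) * psi' q t (k - 1) j (down j nb) *
         a k powi (weight k l - weight (k - 1) nb + 1)) =
      link q t a k l nb * a k * (trigV D k l n (down j nb) nb * T k nb l j)" for j
    unfolding pow using psi k by (simp add: T_coef_def link_def)
  have "(\<Sum>lb | interlaces k lb l. trigV D k l n lb nb * link q t a k l lb * Q (k - 1) lb nb) =
      trigV D k l n nb nb * link q t a k l nb * Q (k - 1) nb nb +
      link q t a k l nb * a k * (\<Sum>j \<in> {1..k - 1}. trigV D k l n (down j nb) nb * T k nb l j)"
    unfolding sum_link_rate[OF k GT, of "\<lambda>lb. trigV D k l n lb nb"] X sum_distrib_left ..
  also have "(\<Sum>j \<in> {1..k - 1}. trigV D k l n (down j nb) nb * T k nb l j) =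
      (\<Sum>j \<in> moves k nb l. trigV D k l n (down j nb) nb * T k nb l j)"
    using T_zero[OF assms] by (intro sum.mono_neutral_right) (auto simp: moves_def)
  finally show ?thesis
    by (simp add: algebra_simps)
qed

lemma link_nonzero:
  assumes "interlaces k nb l"
  shows "link q t a k l nb \<noteq> 0"
proof -
  have "P (k - 1) nb > 0" "P k l > 0" "a k > 0"
    using assms k by (auto simp: interlaces_def intro!: P_pos a_pos)
  then show ?thesis
    using psi_pos'[OF assms] k by (simp add: link_def)
qed

lemma trigV_same:
  assumes "interlaces k nb l" "n \<in> GT k"
  shows "trigV D k l n nb nb = of_bool (l = n)"
proof -
  have "nb \<in> steps (k - 1) nb"
    using assms by (simp add: interlaces_def steps_def)
  then show ?thesis
    using V assms by (simp add: trigV_rules_def)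
qed

text \<open>The right-hand side is likewise \<open>a k * S k nb l m\<close> times
  \<open>link q t a k l nb\<close>, the factor \<open>a k\<close> coming from the larger weight of
  \<open>up m l\<close>; the nonzero common factor is cancelled.\<close>

lemma consistent_at_up_interlaced:
  assumes "interlaces k nb l" "m \<in> Fset k nb l"
  shows "consistent_at k D l (up m l) nb \<longleftrightarrow>
     (\<Sum>j \<in> moves k nb l. trigV D k l (up m l) (down j nb) nb * T k nb l j)
       + rateW D k l (up m l) nb / a k = S k nb l m" (is "_ \<longleftrightarrow> ?s + _ = _")
proof -
  have up: "interlaces k nb (up m l)" and m: "m \<in> {1..k}"
    using assms interlaces_up_iff by (auto simp: Fset_def)
  have pos: "P (k - 1) nb > 0" "P k l > 0" "P k (up m l) > 0" "a k > 0" "psi q t k l nb > 0"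
    using assms k up by (auto simp: interlaces_def intro!: P_pos a_pos psi_pos')
  have "Q k l (up m l) * link q t a k (up m l) nb = link q t a k l nb * (a k * S k nb l m)"
  proof -
    have "a k powi (weight k (up m l) - weight (k - 1) nb) =
        a k powi (weight k l - weight (k - 1) nb) * a k"
      using pos weight_up[OF m, of l] power_int_add_1[of "a k" "weight k l - weight (k - 1) nb"]
      by (simp add: algebra_simps)
    then show ?thesis
      using pos k m by (simp add: Q_up link_def S_coef_def)
  qed
  moreover have "trigV D k l (up m l) nb nb = 0"
    using trigV_same assms up by (simp add: interlaces_def)
  ultimately have "consistent_at k D l (up m l) nb \<longleftrightarrow>
      link q t a k l nb * (a k * (?s + rateW D k l (up m l) nb / a k)) =
      link q t a k l nb * (a k * S k nb l m)"
    unfolding consistent_at_def sum_flow_interlaced[OF assms(1)] using pos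
    by (simp add: algebra_simps)
  then show ?thesis
    using link_nonzero[OF assms(1)] pos by simp
qed

text \<open>The diagonal values are 1 minus, respectively minus, the off-diagonal sums. Summing the
  balance equations over \<open>m\<close> therefore eliminates all of \<open>V\<close> and
  \<open>W\<close> and leaves only \<open>T\<close> and \<open>S\<close>.\<close>

lemma consistent_at_diag:
  assumes "interlaces k nb l" and "\<forall>m \<in> Fset k nb l.
     (\<Sum>j \<in> moves k nb l. trigV D k l (up m l) (down j nb) nb * T k nb l j)
       + rateW D k l (up m l) nb / a k = S k nb l m"
  shows "consistent_at k D l l nb \<longleftrightarrow> Q k l l - Q (k - 1) nb nb =
     a k * ((\<Sum>j \<in> moves k nb l. T k nb l j) - (\<Sum>m \<in> Fset k nb l. S k nb l m))"
proof -
  let ?V = "\<lambda>m j. trigV D k l (up m l) (down j nb) nb" and ?W = "\<lambda>m. rateW D k l (up m l) nb"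
  have a: "a k > 0"
    using a_pos[of k] k by simp
  have W': "a k * (\<Sum>j \<in> moves k nb l. ?V m j * T k nb l j) + ?W m = a k * S k nb l m"
    if "m \<in> Fset k nb l" for m
  proof -
    show ?thesis
      unfolding assms(2)[rule_format, OF that, symmetric] using a by (simp add: distrib_left)
  qed
  have "a k * (\<Sum>j \<in> moves k nb l. trigV D k l l (down j nb) nb * T k nb l j) =
      a k * (\<Sum>j \<in> moves k nb l. T k nb l j) -
      a k * (\<Sum>j \<in> moves k nb l. \<Sum>m \<in> Fset k nb l. ?V m j * T k nb l j)"
  proof -
    have "(\<Sum>j \<in> moves k nb l. trigV D k l l (down j nb) nb * T k nb l j) =
        (\<Sum>j \<in> moves k nb l. T k nb l j - (\<Sum>m \<in> Fset k nb l. ?V m j * T k nb l j))"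
      by (intro sum.cong refl)
        (simp only: trigV_diag[OF V assms(1)] left_diff_distrib mult_1_left sum_distrib_right)
    then show ?thesis
      by (simp only: sum_subtractf right_diff_distrib)
  qed
  also have "a k * (\<Sum>j \<in> moves k nb l. \<Sum>m \<in> Fset k nb l. ?V m j * T k nb l j) =
      (\<Sum>m \<in> Fset k nb l. a k * (\<Sum>j \<in> moves k nb l. ?V m j * T k nb l j))"
    by (subst sum.swap) (simp add: sum_distrib_left)
  also have "\<dots> = (\<Sum>m \<in> Fset k nb l. a k * S k nb l m - ?W m)"
    by (intro sum.cong refl) (simp add: W'[symmetric])
  also have "\<dots> = a k * (\<Sum>m \<in> Fset k nb l. S k nb l m) + rateW D k l l nb"
    using rateW_diag[OF W assms(1)] by (simp add: sum_subtractf sum_distrib_left)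
  finally have *: "a k * (\<Sum>j \<in> moves k nb l. trigV D k l l (down j nb) nb * T k nb l j) + rateW D k l l nb =
      a k * ((\<Sum>j \<in> moves k nb l. T k nb l j) - (\<Sum>m \<in> Fset k nb l. S k nb l m))"
    by (simp add: algebra_simps)
  have "consistent_at k D l l nb \<longleftrightarrow> link q t a k l nb * (Q (k - 1) nb nb +
      (a k * (\<Sum>j \<in> moves k nb l. trigV D k l l (down j nb) nb * T k nb l j) + rateW D k l l nb)) =
      link q t a k l nb * Q k l l"
    unfolding consistent_at_def sum_flow_interlaced[OF assms(1)]
    using trigV_same[OF assms(1), of l] assms(1) by (simp add: algebra_simps interlaces_def)
  then show ?thesis
    unfolding * using link_nonzero[OF assms(1)] by auto
qed

text \<open>Here \<open>link q t a k l nb\<close> is 0, which removes \<open>W\<close>, and the only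
  predecessor contributing is \<open>down m nb\<close>, whose triggered probability is forced to be
  1.\<close>

lemma consistent_at_short_range:
  assumes "l \<in> GT k" "m \<in> {1..k}" "interlaces k nb (up m l)" "\<not> interlaces k nb l"
  shows "consistent_at k D l (up m l) nb \<longleftrightarrow>
     psi q t k l (down m nb) * psi' q t (k - 1) m (down m nb) =
     psi' q t k m l * psi q t k (up m l) nb"
proof -
  note c = interlaces_up_cases[OF assms(3,1,2,4)]
  have nb: "nb \<in> GT (k - 1)"
    using assms by (simp add: interlaces_def)
  have pos: "P (k - 1) nb > 0" "P k l > 0" "P k (up m l) > 0" "a k > 0"
    using assms k by (auto simp: interlaces_def intro!: P_pos a_pos)
  have link0: "link q t a k l nb = 0"
    using assms k by (simp add: link_def psi_def)
  define C where "C = P (k - 1) nb / P k l * a k powi (weight k l - weight (k - 1) nb + 1)"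
  have C: "C \<noteq> 0"
    using pos by (simp add: C_def)
  have V1: "trigV D k l (up m l) (down m nb) nb = 1"
    using trigV_short_range[OF V c(2) c(1)] nb assms by simp
  have "(\<Sum>lb | interlaces k lb l. trigV D k l (up m l) lb nb * link q t a k l lb * Q (k - 1) lb nb) =
      (\<Sum>j \<in> {1..k - 1}. trigV D k l (up m l) (down j nb) nb *
        (P (k - 1) nb / P k l * psi q t k l (down j nb) * psi' q t (k - 1) j (down j nb) *
         a k powi (weight k l - weight (k - 1) nb + 1)))"
    by (subst sum_link_rate[OF k assms(1) nb]) (simp add: link0)
  also have "\<dots> = (\<Sum>j \<in> {1..k - 1}. if j = m then
      C * (psi q t k l (down m nb) * psi' q t (k - 1) m (down m nb)) else 0)"
  proof (rule sum.cong[OF refl])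
    fix j assume j: "j \<in> {1..k - 1}"
    show "trigV D k l (up m l) (down j nb) nb *
        (P (k - 1) nb / P k l * psi q t k l (down j nb) * psi' q t (k - 1) j (down j nb) *
         a k powi (weight k l - weight (k - 1) nb + 1)) =
        (if j = m then C * (psi q t k l (down m nb) * psi' q t (k - 1) m (down m nb)) else 0)"
    proof (cases "j = m")
      case True
      then show ?thesis
        by (simp add: V1 C_def)
    next
      case False
      then have "psi q t k l (down j nb) = 0"
        using c(3)[OF j] by (auto simp: psi_def)
      then show ?thesis
        using False by simp
    qed
  qed
  also have "\<dots> = C * (psi q t k l (down m nb) * psi' q t (k - 1) m (down m nb))"
    using c(1) by simp
  finally have "consistent_at k D l (up m l) nb \<longleftrightarrow>
      C * (psi q t k l (down m nb) * psi' q t (k - 1) m (down m nb)) =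
      Q k l (up m l) * link q t a k (up m l) nb"
    by (simp add: consistent_at_def link0)
  also have "Q k l (up m l) * link q t a k (up m l) nb =
      C * (psi' q t k m l * psi q t k (up m l) nb)"
  proof -
    have w: "weight k l - weight (k - 1) nb + 1 = weight k (up m l) - weight (k - 1) nb"
      using weight_up[OF assms(2), of l] by simp
    show ?thesis
      unfolding C_def w using pos k assms(2) by (simp add: Q_up link_def)
  qed
  finally show ?thesis
    using C by simp
qed

lemma consistent_iff:
  "consistent q t a k D \<longleftrightarrow> balanced k D \<and> short_range_identity k \<and> diagonal_identity k"
proof -
  have c: "consistent q t a k D \<longleftrightarrow>
      (\<forall>l \<in> GT k. \<forall>n \<in> GT k. \<forall>nb. interlaces k nb n \<longrightarrow> consistent_at k D l n nb)"
    by (simp add: consistent_def consistent_at_def)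
  show ?thesis
  proof
    assume con: "consistent q t a k D"
    have bal: "balanced k D"
      unfolding balanced_def
    proof (intro allI impI ballI)
      fix l nb m assume i: "interlaces k nb l" "m \<in> Fset k nb l"
      then have "interlaces k nb (up m l)"
        by (simp add: interlaces_up_iff)
      then have "consistent_at k D l (up m l) nb"
        using con c i by (simp add: interlaces_def)
      then show "(\<Sum>j \<in> moves k nb l. trigV D k l (up m l) (down j nb) nb * T k nb l j)
       + rateW D k l (up m l) nb / a k = S k nb l m"
        using consistent_at_up_interlaced[OF i] by simp
    qed
    moreover have "short_range_identity k"
      unfolding short_range_identity_def
      using con c consistent_at_short_range by (auto simp: interlaces_def)
    moreover have "diagonal_identity k"
      unfolding diagonal_identity_def
    proof (intro allI impI)
      fix l nb assume i: "interlaces k nb l"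
      then have "consistent_at k D l l nb"
        using con c by (simp add: interlaces_def)
      then show "Q k l l - Q (k - 1) nb nb =
          a k * ((\<Sum>j \<in> moves k nb l. T k nb l j) - (\<Sum>m \<in> Fset k nb l. S k nb l m))"
        using bal i consistent_at_diag[OF i] by (simp add: balanced_def)
    qed
    ultimately show "balanced k D \<and> short_range_identity k \<and> diagonal_identity k"
      by blast
  next
    assume r: "balanced k D \<and> short_range_identity k \<and> diagonal_identity k"
    have "consistent_at k D l n nb"
      if l: "l \<in> GT k" and n: "n \<in> GT k" and nb: "interlaces k nb n" for l n nb
    proof (cases "n \<in> steps k l")
      case False
      then show ?thesis
        using k W V l n nb by (intro consistent_at_no_step) (auto simp: interlaces_def)
    next
      case True
      then consider "n = l" | m where "n = up m l" "m \<in> {1..k}"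
        by (auto simp: steps_def)
      then show ?thesis
      proof cases
        case 1
        then show ?thesis
          using r nb consistent_at_diag[of nb l] by (simp add: balanced_def diagonal_identity_def)
      next
        case 2
        show ?thesis
        proof (cases "interlaces k nb l")
          case True
          then have "m \<in> Fset k nb l"
            using nb 2 interlaces_up_iff by simp
          then show ?thesis
            using r True 2 consistent_at_up_interlaced[OF True] by (simp add: balanced_def)
        next
          case False
          then show ?thesis
            using r 2 l nb consistent_at_short_range[of l m nb] by (simp add: short_range_identity_def)
        qed
      qed
    qed
    then show "consistent q t a k D"
      by (simp add: c)
  qed
qed

end

end

section \<open>The sum rule for \<open>S\<close> and \<open>T\<close>\<close>

text \<open>On level 1 the only step is \<open>up 1 l\<close>, \<open>P\<close> is the monomial
  \<open>a 1 powi l 1\<close>, and \<open>psi'\<close> is an empty product.\<close>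

lemma (in macdonald) Q_1:
  assumes "l \<in> GT 1" "N \<ge> 1"
  shows "Q 1 l l = - a 1"
proof -
  have up: "up 1 l \<in> GT 1"
    using assms by (auto simp: GT_def up_def)
  have "steps 1 l - {l} = {up 1 l}"
    using up assms by (auto simp: steps_minus)
  moreover have "offdiag_rate q t a 1 l (up 1 l) = a 1"
  proof -
    have "a 1 > 0"
      using assms by (intro a_pos) auto
    then have "P 1 (up 1 l) / P 1 l = a 1"
      unfolding mac_P_1[OF up] mac_P_1[OF assms(1)]
      by (simp add: up_def power_int_add_1)
    moreover have "psi' q t 1 1 l = 1"
      using up assms by (simp add: psi'_def)
    ultimately have "Q 1 l (up 1 l) = a 1"
      by (simp add: Q_up)
    then show ?thesis
      by (simp add: uni_rate_def)
  qed
  ultimately show ?thesis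
    by (simp add: uni_rate_def)
qed

text \<open>At the lowest signature the sum of \<open>T\<close> is empty and the sum of
  \<open>S\<close> is the single value 1.\<close>

lemma (in macdonald) Q_diag_lowest:
  assumes "diagonal_identity k" "k \<ge> 1" "k \<le> N" "l \<in> GT k"
  shows "Q k l l = Q (k - 1) (lowest k l) (lowest k l) - a k"
proof -
  note low = interlaces_lowest[OF assms(4)]
  have F: "Fset k (lowest k l) l = {1}"
    using assms by (intro Fset_lowest) simp
  then have up: "interlaces k (lowest k l) (up 1 l)"
    using interlaces_up_iff[OF low, of 1] by simp
  have "psi q t k l (lowest k l) = 1" "psi q t k (up 1 l) (lowest k l) = 1"
    using q t low up by (auto intro!: psi_lowest simp: up_def)
  moreover have "psi' q t k 1 l = 1"
    using up assms by (simp add: psi'_def interlaces_def)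
  ultimately have "S k (lowest k l) l 1 = 1"
    by (simp add: S_coef_def)
  moreover have "moves k (lowest k l) l = {}"
    using F by (auto simp: moves_def)
  ultimately show ?thesis
    using assms(1) low F by (fastforce simp: diagonal_identity_def)
qed

lemma (in macdonald) Q_diag:
  assumes "\<forall>k \<in> {2..N}. diagonal_identity k"
  shows "1 \<le> k \<Longrightarrow> k \<le> N \<Longrightarrow> l \<in> GT k \<Longrightarrow> Q k l l = - (\<Sum>i = 1..k. a i)"
proof (induction k arbitrary: l rule: nat_induct_at_least)
  case base
  then show ?case
    using Q_1[of l] by simp
next
  case (Suc k)
  have "lowest (Suc k) l \<in> GT k"
    using interlaces_lowest[OF Suc.prems(2)] by (simp add: interlaces_def)
  then show ?case
    using Q_diag_lowest[of "Suc k" l] assms Suc by simp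
qed

text \<open>By \<open>Q_diag\<close> the two diagonal rates differ by exactly \<open>a k\<close>
  whatever \<open>l\<close> and \<open>nb\<close> are; dividing the diagonal identity by
  \<open>a k\<close> gives the claim.\<close>

lemma (in macdonald) sum_S_eq:
  assumes "\<forall>k \<in> {2..N}. diagonal_identity k" "k \<in> {2..N}" "interlaces k nb l"
  shows "(\<Sum>m \<in> Fset k nb l. S k nb l m) = 1 + (\<Sum>j \<in> moves k nb l. T k nb l j)"
proof -
  obtain k' where k': "k = Suc k'" "k' \<ge> 1" "k' < N"
    using assms(2) by (cases k) auto
  have "Q k l l = Q (k - 1) nb nb - a k"
    using assms k' Q_diag[OF assms(1), of k l] Q_diag[OF assms(1), of k' nb]
    by (simp add: interlaces_def)
  moreover have "Q k l l - Q (k - 1) nb nb =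
      a k * ((\<Sum>j \<in> moves k nb l. T k nb l j) - (\<Sum>m \<in> Fset k nb l. S k nb l m))"
    using assms by (simp add: diagonal_identity_def)
  ultimately have "a k * ((\<Sum>m \<in> Fset k nb l. S k nb l m) - (\<Sum>j \<in> moves k nb l. T k nb l j)) = a k * 1"
    by (simp add: algebra_simps)
  then have "(\<Sum>m \<in> Fset k nb l. S k nb l m) - (\<Sum>j \<in> moves k nb l. T k nb l j) = 1"
    using a_pos[of k] assms(2) by (simp only: mult_cancel_left) auto
  then show ?thesis by simp
qed

section \<open>The fundamental rules\<close>

lemma one_in_Fset: "k \<ge> 1 \<Longrightarrow> 1 \<in> Fset k nb l"
  by (simp add: Fset_def)

lemma xi_in:
  assumes "k \<ge> 1" "i \<ge> 1"
  shows "xi k nb l i \<in> Fset k nb l" "xi k nb l i \<le> i"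
proof -
  have "xi k nb l i \<in> {j \<in> Fset k nb l. j \<le> i}"
    unfolding xi_def using one_in_Fset[OF assms(1), of nb l] assms(2) by (intro Max_in) auto
  then show "xi k nb l i \<in> Fset k nb l" "xi k nb l i \<le> i"
    by auto
qed

lemma xi_eq_iff:
  assumes "k \<ge> 1" "i \<ge> 1" "m \<in> Fset k nb l"
  shows "xi k nb l i = m \<longleftrightarrow> m \<le> i \<and> (\<forall>j \<in> Fset k nb l. j \<le> i \<longrightarrow> j \<le> m)"
proof -
  have "\<forall>j \<in> Fset k nb l. j \<le> i \<longrightarrow> j \<le> xi k nb l i"
    by (auto simp: xi_def)
  then show ?thesis
    using xi_in[OF assms(1,2), of nb l] assms(3) by (auto intro: antisym)
qed

text \<open>\<open>e\<close> is the last index before the next element of \<open>Fset\<close>, or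
  \<open>k\<close> if there is none; \<open>{m..e}\<close> is the block on which \<open>xi\<close>
  takes the value \<open>m\<close>.\<close>

lemma Fset_gap_end:
  assumes "m \<in> Fset k nb l"
  obtains e where "m \<le> e" "e \<le> k" "\<And>i. i \<in> Fset k nb l \<Longrightarrow> m < i \<Longrightarrow> e < i"
    "e < k \<Longrightarrow> e + 1 \<in> Fset k nb l"
proof -
  let ?G = "{e \<in> {m..k}. \<forall>i \<in> Fset k nb l. m < i \<longrightarrow> e < i}"
  have m: "m \<in> ?G"
    using assms by (auto simp: Fset_def)
  then have "Max ?G \<in> ?G"
    by (intro Max_in) auto
  moreover have "Max ?G + 1 \<in> Fset k nb l" if "Max ?G < k"
  proof (rule ccontr)
    assume "Max ?G + 1 \<notin> Fset k nb l"
    with \<open>Max ?G \<in> ?G\<close> that have "Max ?G + 1 \<in> ?G"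
      by (auto intro: le_neq_implies_less simp: Suc_le_eq)
    then have "Max ?G + 1 \<le> Max ?G"
      by (intro Max_ge) auto
    then show False by simp
  qed
  ultimately show ?thesis
    using that[of "Max ?G"] by auto
qed

text \<open>For RSK the bound \<open>h <= k\<close> makes the telescoping sum end at 0. For R(h) and
  L(h), an \<open>h\<close> outside \<open>moves\<close> gives \<open>T k nb l h = 0\<close>, and
  the rule then balances as PB does.\<close>

fun admissible :: "nat \<Rightarrow> slice_rule \<Rightarrow> bool" where
  "admissible k (RSK h) = (h \<in> {1..k})"
| "admissible k _ = True"

text \<open>Telescoping: in the equation for \<open>m\<close>, pushing contributes
  \<open>R e\<close> from the end \<open>e\<close> of the block of \<open>m\<close>, pulling
  contributes \<open>T - R\<close> at \<open>m - 1\<close>, and the independent jump contributes the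
  indicator of \<open>m <= h <= e\<close>. The difference of the partial sums is
  \<open>S k nb l m\<close>.\<close>

lemma (in macdonald) slice_balance_RSK:
  assumes k: "k \<in> {2..N}" and i: "interlaces k nb l" and m: "m \<in> Fset k nb l" and h: "h \<in> {1..k}"
    and tot: "(\<Sum>m \<in> Fset k nb l. S k nb l m) = 1 + (\<Sum>j \<in> moves k nb l. T k nb l j)"
  shows "(\<Sum>j \<in> moves k nb l. slice_V q t (RSK h) k nb l j m * T k nb l j)
    + slice_W q t a (RSK h) k nb l m / a k = S k nb l m"
proof -
  let ?F = "Fset k nb l" and ?M = "moves k nb l"
  \<comment> \<open>\<open>A\<close> includes its endpoint and \<open>B\<close> stops before it, as
    in \<open>rsk_r\<close>, so that \<open>R j\<close> equals \<open>rsk_r\<close> times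
    \<open>T k nb l j\<close>.\<close>
  define A where "A n = (\<Sum>i = 1..n. S k nb l i)" for n
  define B where "B n = (\<Sum>i = 1..<n. T k nb l i)" for n
  define R where "R j = A j - B j - of_bool (h \<le> j)" for j
  have m1: "m \<ge> 1" "m \<le> k" and k1: "k \<ge> 1"
    using m k by (auto simp: Fset_def)
  obtain e where e: "m \<le> e" "e \<le> k" "\<And>i. i \<in> ?F \<Longrightarrow> m < i \<Longrightarrow> e < i" "e < k \<Longrightarrow> e + 1 \<in> ?F"
    using Fset_gap_end[OF m] by blast
  \<comment> \<open>Boundary value: the surplus 1 of the sum rule is cancelled by
    \<open>of_bool (h <= k)\<close>.\<close>
  have "A k = (\<Sum>m \<in> ?F. S k nb l m)"
    unfolding A_def using S_zero[OF i] by (intro sum.mono_neutral_right) (auto simp: Fset_def)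
  moreover have "B k = (\<Sum>j \<in> ?M. T k nb l j)"
    unfolding B_def using T_zero[OF i] by (intro sum.mono_neutral_right) (auto simp: moves_def)
  ultimately have Rk: "R k = 0"
    using tot h by (simp add: R_def)
  \<comment> \<open>No element of \<open>Fset\<close> lies strictly above \<open>m\<close> and up to
    \<open>e\<close>, so \<open>S\<close> vanishes for \<open>m < i <= e\<close> and, below,
    \<open>T\<close> vanishes for \<open>m <= i < e\<close>.\<close>
  have Ae: "A e = A (m - 1) + S k nb l m"
  proof -
    have "A e = (\<Sum>i = 1..m. S k nb l i)"
      unfolding A_def
    proof (intro sum.mono_neutral_right ballI)
      fix i assume "i \<in> {1..e} - {1..m}"
      then have "i \<notin> ?F"
        using e(3)[of i] by auto
      then show "S k nb l i = 0"
        using S_zero[OF assms(2)] by simp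
    qed (use e in auto)
    also have "\<dots> = A (m - 1) + S k nb l m"
      unfolding A_def using m1 by (cases m) auto
    finally show ?thesis .
  qed
  have Be: "B e = B m"
    unfolding B_def
  proof (intro sum.mono_neutral_right ballI)
    fix i assume "i \<in> {1..<e} - {1..<m}"
    then have "i \<notin> ?M"
      using e(3)[of "i + 1"] by (auto simp: moves_def)
    then show "T k nb l i = 0"
      using T_zero[OF assms(2)] by simp
  qed (use e in auto)
  have xi_e': "xi k nb l j = m \<longleftrightarrow> m \<le> j \<and> j \<le> e" if j: "1 \<le> j" "j \<le> k" for j
  proof -
    have "j \<le> e" if "\<forall>i \<in> ?F. i \<le> j \<longrightarrow> i \<le> m"
    proof (rule ccontr)
      assume "\<not> j \<le> e"
      then have "e + 1 \<in> ?F" "e + 1 \<le> j"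
        using e(4) j by auto
      then show False
        using that e(1) by fastforce
    qed
    moreover have "i \<le> m" if "j \<le> e" "i \<in> ?F" "i \<le> j" for i
      using e(3)[OF that(2)] that by linarith
    ultimately show ?thesis
      using xi_eq_iff[OF k1 j(1) m] by blast
  qed
  \<comment> \<open>A move \<open>j\<close> has \<open>j + 1\<close> in \<open>Fset\<close>, so
    within the block of \<open>m\<close> it can only be the last index.\<close>
  have xi_e: "m = xi k nb l j \<longleftrightarrow> j = e" if j: "j \<in> ?M" for j
  proof -
    have j1: "j \<ge> 1" "j + 1 \<in> ?F" "j < k"
      using j by (auto simp: moves_def)
    have "xi k nb l j = m \<longleftrightarrow> m \<le> j \<and> j \<le> e"
      using xi_e'[of j] j1 by simp
    moreover have "e \<le> j" if "m \<le> j"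
      using e(3)[OF j1(2)] that by simp
    ultimately show ?thesis
      using e(1) by auto
  qed
  have "slice_V q t (RSK h) k nb l j m * T k nb l j =
      (if j = e then R j else 0) + (if j + 1 = m then T k nb l j - R j else 0)" if j: "j \<in> ?M" for j
  proof -
    have "rsk_r q t h k nb l j * T k nb l j = R j"
      using T_nonzero[OF i j] by (simp add: rsk_r_def R_def A_def B_def)
    then show ?thesis
      using xi_e[OF j] by (auto simp: algebra_simps)
  qed
  then have "(\<Sum>j \<in> ?M. slice_V q t (RSK h) k nb l j m * T k nb l j) =
      (\<Sum>j \<in> ?M. if j = e then R j else 0) + (\<Sum>j \<in> ?M. if j + 1 = m then T k nb l j - R j else 0)"
    by (simp add: sum.distrib)
  \<comment> \<open>For \<open>e = k\<close> there is no such move, but then \<open>R e\<close> is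
    0.\<close>
  also have "(\<Sum>j \<in> ?M. if j = e then R j else 0) = R e"
  proof (cases "e = k")
    case True
    then show ?thesis
      using Rk by simp
  next
    case False
    then have "e \<in> ?M"
      using e m1 by (auto simp: moves_def)
    then show ?thesis by simp
  qed
  \<comment> \<open>The term \<open>T\<close> at \<open>m - 1\<close> extends
    \<open>B (m - 1)\<close> to \<open>B m\<close>. For \<open>m = 1\<close> there is no such move,
    and the right-hand side is 0 because \<open>h >= 1\<close>.\<close>
  also have "(\<Sum>j \<in> ?M. if j + 1 = m then T k nb l j - R j else 0) =
      B m - A (m - 1) + of_bool (h < m)"
  proof (cases "m = 1")
    case True
    then have "(\<Sum>j \<in> ?M. if j + 1 = m then T k nb l j - R j else 0) = 0"
      by (intro sum.neutral) (auto simp: moves_def)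
    then show ?thesis
      using True h by (simp add: A_def B_def)
  next
    case False
    then obtain m' where m': "m = m' + 1" "m' \<ge> 1"
      using m1 by (cases m) auto
    then have "m' \<in> ?M"
      using m by (auto simp: moves_def Fset_def)
    then have "(\<Sum>j \<in> ?M. if j + 1 = m then T k nb l j - R j else 0) = T k nb l m' - R m'"
      using m' by simp
    also have "\<dots> = B m - A m' + of_bool (h < m)"
      using m' by (simp add: R_def B_def less_Suc_eq_le)
    finally show ?thesis
      using m' by simp
  qed
  \<comment> \<open>\<open>of_bool (h <= e) - of_bool (h < m)\<close> is the indicator of
    \<open>m <= h <= e\<close>, that is, of \<open>xi k nb l h = m\<close>.\<close>
  finally show ?thesis
    using a_pos[of k] k xi_e'[of h] Ae Be h m1 e(1) by (auto simp: R_def)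
qed

text \<open>For R and L, the amount \<open>T k nb l h\<close> that the triggered move adds is
  exactly what is subtracted from the rate.\<close>

lemma (in macdonald) slice_balance:
  assumes "k \<in> {2..N}" "interlaces k nb l" "m \<in> Fset k nb l" "admissible k r"
    and "(\<Sum>m \<in> Fset k nb l. S k nb l m) = 1 + (\<Sum>j \<in> moves k nb l. T k nb l j)"
  shows "(\<Sum>j \<in> moves k nb l. slice_V q t r k nb l j m * T k nb l j)
    + slice_W q t a r k nb l m / a k = S k nb l m"
proof -
  have "a k > 0"
    using assms by (intro a_pos) auto
  moreover have "(\<Sum>j \<in> moves k nb l. of_bool (j = h) * c * T k nb l j) = c * T k nb l h" for c h
  proof -
    have "(\<Sum>j \<in> moves k nb l. of_bool (j = h) * c * T k nb l j) =
        (\<Sum>j \<in> moves k nb l. if j = h then c * T k nb l h else 0)"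
      by (intro sum.cong) auto
    then show ?thesis
      using T_zero[OF assms(2), of h] by simp
  qed
  moreover have ?thesis if "r = RSK h" for h
    unfolding that using assms that by (intro slice_balance_RSK) auto
  ultimately show ?thesis
    using assms by (cases r) auto
qed

section \<open>The fundamental rules define nearest neighbor dynamics\<close>

lemma rateW_dyn_of:
  assumes "k \<ge> 2" "m \<in> Fset k nb l"
  shows "rateW (dyn_of q t a \<rho>) k l (up m l) nb = slice_W q t a (\<rho> k) k nb l m"
proof -
  have "{m'. m' \<in> Fset k nb l \<and> up m l = up m' l} = {m}"
    using assms by auto
  then show ?thesis
    using assms by (simp add: dyn_of_def)
qed

lemma trigV_dyn_of_eq:
  assumes "interlaces k nb l" "j \<in> moves k nb l"
  shows "trigV (dyn_of q t a \<rho>) k l n (down j nb) nb =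
    (if n = l then 1 - (\<Sum>m \<in> Fset k nb l. slice_V q t (\<rho> k) k nb l j m)
     else \<Sum>m | m \<in> Fset k nb l \<and> n = up m l. slice_V q t (\<rho> k) k nb l j m)"
proof -
  have "{j'. j' \<in> {1..k - 1} \<and> nb = up j' (down j nb)} = {j}"
    using assms by (auto simp: eq_up_iff moves_def)
  then show ?thesis
    using assms by (simp add: dyn_of_def)
qed

lemma trigV_dyn_of:
  assumes "interlaces k nb l" "j \<in> moves k nb l" "m \<in> Fset k nb l"
  shows "trigV (dyn_of q t a \<rho>) k l (up m l) (down j nb) nb = slice_V q t (\<rho> k) k nb l j m"
proof -
  have "{m'. m' \<in> Fset k nb l \<and> up m l = up m' l} = {m}"
    using assms by auto
  then show ?thesis
    using assms by (simp add: trigV_dyn_of_eq)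
qed

lemma (in macdonald) rateW_rules_dyn_of:
  assumes "k \<ge> 1"
  shows "rateW_rules k (dyn_of q t a \<rho>)"
  unfolding rateW_rules_def
proof (intro allI impI)
  fix l lb assume i: "interlaces k lb l"
  let ?W = "\<lambda>n. rateW (dyn_of q t a \<rho>) k l n lb"
  have zero: "?W n = 0" if n: "n \<in> GT k" "n \<notin> steps k l \<or> \<not> interlaces k lb n" for n
  proof (cases "k = 1")
    case True
    then have "n \<notin> steps k l"
      using n i by (auto simp: interlaces_def)
    then show ?thesis
      using True n i by (simp add: dyn_of_def Q_zero interlaces_def)
  next
    case False
    have "n \<noteq> l"
      using n i by (auto simp: steps_def)
    moreover have "{m. m \<in> Fset k lb l \<and> n = up m l} = {}"
      using n interlaces_up_iff[OF i] by (auto simp: steps_def Fset_def)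
    ultimately show ?thesis
      using False by (simp add: dyn_of_def del: Collect_empty_eq)
  qed
  moreover have "(\<Sum>n \<in> steps k l - {l}. ?W n) = - ?W l"
  proof (cases "k = 1")
    case True
    then show ?thesis
      by (simp add: dyn_of_def uni_rate_def)
  next
    case False
    have "(\<Sum>n \<in> steps k l - {l}. ?W n) = (\<Sum>m \<in> Fset k lb l. ?W (up m l))"
      using zero by (intro sum_steps[OF i]) auto
    also have "\<dots> = (\<Sum>m \<in> Fset k lb l. slice_W q t a (\<rho> k) k lb l m)"
      using False assms by (intro sum.cong refl rateW_dyn_of) auto
    finally show ?thesis
      using False by (simp add: dyn_of_def)
  qed
  ultimately show "(\<forall>n \<in> GT k. n \<notin> steps k l \<or> \<not> interlaces k lb n \<longrightarrow> ?W n = 0) \<and>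
      (\<Sum>n \<in> steps k l - {l}. ?W n) = - ?W l"
    by blast
qed

lemma trigV_rules_dyn_of: "trigV_rules k (dyn_of q t a \<rho>)"
  unfolding trigV_rules_def
proof (intro allI ballI impI)
  fix l lb nb assume nb: "nb \<in> steps (k - 1) lb" and i: "interlaces k lb l"
  let ?V = "\<lambda>n. trigV (dyn_of q t a \<rho>) k l n lb nb"
  have l: "l \<in> steps k l"
    using i by (simp add: steps_def interlaces_def)
  have "(\<forall>n \<in> GT k. n \<notin> steps k l \<or> \<not> interlaces k nb n \<longrightarrow> ?V n = 0) \<and> (\<Sum>n \<in> steps k l. ?V n) = 1"
  proof (cases "nb = lb")
    case True
    then have "?V n = (if n = l then 1 else 0)" for n
      by (simp add: dyn_of_def)
    then show ?thesis
      using l i True by auto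
  next
    case False
    then obtain j where j: "j \<in> {1..k - 1}" "nb = up j lb"
      using nb by (auto simp: steps_def)
    show ?thesis
    proof (cases "interlaces k nb l")
      case True
      have lb: "lb = down j nb"
        using j by simp
      then have jm: "j \<in> moves k nb l"
        using i interlaces_down_iff[OF True] by simp
      have zero: "?V n = 0" if n: "n \<in> GT k" "n \<notin> steps k l \<or> \<not> interlaces k nb n" for n
      proof -
        have "n \<noteq> l"
          using n l True by auto
        moreover have "{m. m \<in> Fset k nb l \<and> n = up m l} = {}"
          using n interlaces_up_iff[OF True] by (auto simp: steps_def Fset_def)
        ultimately show ?thesis
          unfolding lb by (simp add: trigV_dyn_of_eq[OF True jm] del: Collect_empty_eq)
      qed
      have "(\<Sum>n \<in> steps k l. ?V n) = ?V l + (\<Sum>m \<in> Fset k nb l. ?V (up m l))"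
        using zero by (intro sum_steps'[OF True]) auto
      also have "\<dots> = 1"
        unfolding lb by (simp add: trigV_dyn_of[OF True jm] trigV_dyn_of_eq[OF True jm, of _ _ _ _ l])
      finally show ?thesis
        using zero by blast
    next
      case False
      have "(\<exists>j' \<in> {1..k - 1}. nb = up j' lb \<and> n = up j' l) \<longleftrightarrow> n = up j l" for n
        using j by auto
      then have V: "?V n = (if n = up j l then 1 else 0)" for n
        using False \<open>nb \<noteq> lb\<close> by (simp add: dyn_of_def)
      \<comment> \<open>The move forced by short-range pushing is a legal target, so the total
        probability is 1.\<close>
      have up: "interlaces k nb (up j l)"
        using interlaces_short_range(1)[OF i j(1)] j nb False by (simp add: steps_def)
      then have "up j l \<in> steps k l"
        using j by (auto simp: steps_def interlaces_def)
      then show ?thesis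
        using up by (auto simp: V)
    qed
  qed
  moreover have "trigV (dyn_of q t a \<rho>) k l n lb lb = of_bool (l = n)" for n
    by (auto simp: dyn_of_def)
  ultimately show "(\<forall>n \<in> GT k. n \<notin> steps k l \<or> \<not> interlaces k nb n \<longrightarrow> ?V n = 0) \<and>
      (\<Sum>n \<in> steps k l. ?V n) = 1 \<and> (\<forall>n \<in> GT k. trigV (dyn_of q t a \<rho>) k l n lb lb = of_bool (l = n))"
    by blast
qed

text \<open>On level 1 the rate is \<open>Q 1\<close> itself, the links are 1 and the univariate
  rate on level 0 vanishes.\<close>

lemma (in macdonald) consistent_1:
  "consistent q t a 1 (dyn_of q t a \<rho>)"
  by (auto simp: consistent_def uni_rate_def offdiag_rate_def steps_def link_def dyn_of_def
      interlaces_def intro!: sum.neutral)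

text \<open>The given \<open>D\<close> supplies the two identities of \<open>consistent_iff\<close>
  on every slice; they also yield the sum rule behind \<open>slice_balance\<close>.\<close>

lemma (in macdonald) dynamics_dyn_of:
  assumes D: "dynamics q t a N D" and adm: "\<And>k. k \<in> {2..N} \<Longrightarrow> admissible k (\<rho> k)"
  shows "dynamics q t a N (dyn_of q t a \<rho>)"
proof -
  have id: "short_range_identity k \<and> diagonal_identity k" if k: "k \<in> {2..N}" for k
  proof -
    have "rateW_rules k D" "trigV_rules k D" "consistent q t a k D"
      using D k by (auto simp: dynamics_iff)
    then show ?thesis
      using consistent_iff[OF k] by blast
  qed
  have "consistent q t a k (dyn_of q t a \<rho>)" if k: "k \<in> {2..N}" for k
  proof -
    have "balanced k (dyn_of q t a \<rho>)"
      unfolding balanced_def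
    proof (intro allI impI ballI)
      fix l nb m assume i: "interlaces k nb l" and m: "m \<in> Fset k nb l"
      have "(\<Sum>j \<in> moves k nb l. trigV (dyn_of q t a \<rho>) k l (up m l) (down j nb) nb * T k nb l j) =
          (\<Sum>j \<in> moves k nb l. slice_V q t (\<rho> k) k nb l j m * T k nb l j)"
        using i m by (intro sum.cong refl) (simp add: trigV_dyn_of)
      then show "(\<Sum>j \<in> moves k nb l. trigV (dyn_of q t a \<rho>) k l (up m l) (down j nb) nb * T k nb l j)
          + rateW (dyn_of q t a \<rho>) k l (up m l) nb / a k = S k nb l m"
        using slice_balance[OF k i m adm[OF k]] sum_S_eq[OF _ k i] id m k
        by (simp add: rateW_dyn_of)
    qed
    moreover have "rateW_rules k (dyn_of q t a \<rho>)"
      using k by (intro rateW_rules_dyn_of) simp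
    ultimately show ?thesis
      using consistent_iff[OF k _ trigV_rules_dyn_of] id[OF k] by blast
  qed
  then have "consistent q t a k (dyn_of q t a \<rho>)" if "k \<in> {1..N}" for k
    using that consistent_1 by (cases "k = 1") auto
  then show ?thesis
    by (auto simp: dynamics_iff rateW_rules_dyn_of trigV_rules_dyn_of)
qed

lemma slice_V_nearest:
  assumes "m \<noteq> j + 1" "m \<noteq> xi k nb l j"
  shows "slice_V q t r k nb l j m = 0"
  using assms by (cases r) auto

lemma (in macdonald) nearest_neighbor_dyn_of:
  assumes "dynamics q t a N D" "\<And>k. k \<in> {2..N} \<Longrightarrow> admissible k (\<rho> k)"
  shows "nearest_neighbor q t a N (dyn_of q t a \<rho>)"
  unfolding nearest_neighbor_def
proof (intro conjI ballI allI impI dynamics_dyn_of[OF assms])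
  fix k l nb j m
  assume i: "interlaces k nb l" and j: "j \<in> {1..k - 1}" "j + 1 \<in> Fset k nb l"
    and m: "up m l \<in> GT k \<and> m \<noteq> j + 1 \<and> m \<noteq> xi k nb l j"
  have "j \<in> moves k nb l"
    using j by (simp add: moves_def)
  then show "trigV (dyn_of q t a \<rho>) k l (up m l) (down j nb) nb = 0"
    using m by (auto simp: trigV_dyn_of_eq[OF i] slice_V_nearest intro!: sum.neutral)
qed

lemma admissible_fundamental:
  assumes "\<rho> \<in> fundamental_rules N" "k \<in> {2..N}"
  shows "admissible k (\<rho> k)"
  using assms
  by (auto simp: fundamental_rules_def PB_rules_def RSK_rules_def RPush_rules_def LPull_rules_def
      PiE_def Pi_def)

lemma finite_fundamental_rules: "finite (fundamental_rules N)"
  by (auto simp: fundamental_rules_def PB_rules_def RSK_rules_def RPush_rules_def LPull_rules_def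
      intro!: finite_imageI finite_PiE)

section \<open>Mixing on a slice\<close>

context macdonald
begin

lemma rateW_up_eq:
  assumes "balanced k D" "k \<in> {2..N}" "interlaces k nb l" "m \<in> Fset k nb l"
  shows "rateW D k l (up m l) nb =
    a k * (S k nb l m - (\<Sum>j \<in> moves k nb l. trigV D k l (up m l) (down j nb) nb * T k nb l j))"
proof -
  have "a k > 0"
    using assms by (intro a_pos) auto
  moreover have "S k nb l m = (\<Sum>j \<in> moves k nb l. trigV D k l (up m l) (down j nb) nb * T k nb l j)
      + rateW D k l (up m l) nb / a k"
    using assms by (simp add: balanced_def)
  ultimately show ?thesis by simp
qed

text \<open>
  By the balance equations, the rates on a slice are affine functions of the off-diagonal triggered
  moves, with coefficients independent of the dynamics; so affine combinations only need to be
  checked on these moves.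
\<close>

lemma mixture_on_slice:
  assumes k: "k \<in> {2..N}" and i: "interlaces k nb l"
    and D: "rateW_rules k D" "trigV_rules k D" "balanced k D"
    and E: "\<And>\<alpha>. \<alpha> \<in> I \<Longrightarrow> rateW_rules k (E \<alpha>) \<and> trigV_rules k (E \<alpha>) \<and> balanced k (E \<alpha>)"
    and \<theta>: "(\<Sum>\<alpha> \<in> I. \<theta> \<alpha>) = 1"
    and V: "\<And>j m. j \<in> moves k nb l \<Longrightarrow> m \<in> Fset k nb l \<Longrightarrow>
      trigV D k l (up m l) (down j nb) nb = (\<Sum>\<alpha> \<in> I. \<theta> \<alpha> * trigV (E \<alpha>) k l (up m l) (down j nb) nb)"
    and n: "n \<in> GT k"
  shows "rateW D k l n nb = (\<Sum>\<alpha> \<in> I. \<theta> \<alpha> * rateW (E \<alpha>) k l n nb)" (is ?W)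
    and "interlaces k lb l \<Longrightarrow> nb \<in> steps (k - 1) lb \<Longrightarrow>
      trigV D k l n lb nb = (\<Sum>\<alpha> \<in> I. \<theta> \<alpha> * trigV (E \<alpha>) k l n lb nb)"
proof -
  have W_up: "rateW D k l (up m l) nb = (\<Sum>\<alpha> \<in> I. \<theta> \<alpha> * rateW (E \<alpha>) k l (up m l) nb)"
    if m: "m \<in> Fset k nb l" for m
  proof -
    let ?t = "\<lambda>\<alpha> j. trigV (E \<alpha>) k l (up m l) (down j nb) nb * T k nb l j"
    have "(\<Sum>\<alpha> \<in> I. \<theta> \<alpha> * rateW (E \<alpha>) k l (up m l) nb) =
        (\<Sum>\<alpha> \<in> I. a k * (\<theta> \<alpha> * S k nb l m - (\<Sum>j \<in> moves k nb l. \<theta> \<alpha> * ?t \<alpha> j)))"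
    proof (intro sum.cong refl)
      fix \<alpha> assume "\<alpha> \<in> I"
      then have "balanced k (E \<alpha>)"
        using E by blast
      note eq = rateW_up_eq[OF this k i m]
      show "\<theta> \<alpha> * rateW (E \<alpha>) k l (up m l) nb =
          a k * (\<theta> \<alpha> * S k nb l m - (\<Sum>j \<in> moves k nb l. \<theta> \<alpha> * ?t \<alpha> j))"
        unfolding eq sum_distrib_left[symmetric] by (simp only: right_diff_distrib mult.left_commute)
    qed
    also have "\<dots> = a k * ((\<Sum>\<alpha> \<in> I. \<theta> \<alpha>) * S k nb l m - (\<Sum>\<alpha> \<in> I. \<Sum>j \<in> moves k nb l. \<theta> \<alpha> * ?t \<alpha> j))"
      by (simp only: sum_distrib_left[symmetric] sum_distrib_right[symmetric] sum_subtractf)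
    also have "(\<Sum>\<alpha> \<in> I. \<Sum>j \<in> moves k nb l. \<theta> \<alpha> * ?t \<alpha> j) =
        (\<Sum>j \<in> moves k nb l. trigV D k l (up m l) (down j nb) nb * T k nb l j)"
      by (subst sum.swap) (simp add: V m sum_distrib_right mult.assoc)
    finally show ?thesis
      using rateW_up_eq[OF D(3) k i m] \<theta> by simp
  qed
  \<comment> \<open>Three kinds of target: the diagonal one, the raises compatible with
    \<open>nb\<close>, and those at which all values vanish.\<close>
  have cases: thesis if "n = l \<Longrightarrow> thesis" "\<And>m. m \<in> Fset k nb l \<Longrightarrow> n = up m l \<Longrightarrow> thesis"
    "n \<notin> steps k l \<or> \<not> interlaces k nb n \<Longrightarrow> thesis" for thesis
    using that interlaces_up_iff[OF i] by (auto simp: steps_def)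
  show ?W
  proof (rule cases)
    assume n: "n = l"
    have "rateW D k l l nb = - (\<Sum>m \<in> Fset k nb l. \<Sum>\<alpha> \<in> I. \<theta> \<alpha> * rateW (E \<alpha>) k l (up m l) nb)"
      using rateW_diag[OF D(1) i] W_up by simp
    also have "\<dots> = (\<Sum>\<alpha> \<in> I. \<theta> \<alpha> * (- (\<Sum>m \<in> Fset k nb l. rateW (E \<alpha>) k l (up m l) nb)))"
      by (subst sum.swap) (simp add: sum_distrib_left sum_negf)
    also have "\<dots> = (\<Sum>\<alpha> \<in> I. \<theta> \<alpha> * rateW (E \<alpha>) k l l nb)"
      using E rateW_diag[OF _ i] by (intro sum.cong refl) simp
    finally show ?thesis
      using n by simp
  next
    assume "n \<notin> steps k l \<or> \<not> interlaces k nb n"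
    then have "rateW D k l n nb = 0" "\<forall>\<alpha> \<in> I. rateW (E \<alpha>) k l n nb = 0"
      using D(1) E i n unfolding rateW_rules_def by blast+
    then show ?thesis by simp
  qed (simp add: W_up)
  assume lb: "interlaces k lb l" "nb \<in> steps (k - 1) lb"
  show "trigV D k l n lb nb = (\<Sum>\<alpha> \<in> I. \<theta> \<alpha> * trigV (E \<alpha>) k l n lb nb)"
  proof (cases "lb = nb")
    case True
    have "trigV D k l n lb nb = of_bool (l = n)"
      using trigV_same[OF k D(1,2) i n] True by simp
    moreover have "trigV (E \<alpha>) k l n lb nb = of_bool (l = n)" if "\<alpha> \<in> I" for \<alpha>
      using trigV_same[OF k _ _ i n] E[OF that] True by blast
    ultimately show ?thesis
      using \<theta> by (simp add: sum_distrib_right[symmetric])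
  next
    case False
    then obtain j where "nb = up j lb"
      using lb by (auto simp: steps_def)
    then have j: "lb = down j nb" by simp
    then have jm: "j \<in> moves k nb l"
      using lb interlaces_down_iff[OF i] by simp
    show ?thesis
    proof (rule cases)
      assume n: "n = l"
      \<comment> \<open>The diagonal value is 1 minus a linear expression; its constant term is
        preserved because the weights sum to 1.\<close>
      have "trigV D k l l lb nb =
          (\<Sum>\<alpha> \<in> I. \<theta> \<alpha>) - (\<Sum>m \<in> Fset k nb l. \<Sum>\<alpha> \<in> I. \<theta> \<alpha> * trigV (E \<alpha>) k l (up m l) lb nb)"
        using trigV_diag[OF D(2) i jm] V[OF jm] \<theta> by (simp add: j)
      also have "\<dots> = (\<Sum>\<alpha> \<in> I. \<theta> \<alpha> * (1 - (\<Sum>m \<in> Fset k nb l. trigV (E \<alpha>) k l (up m l) lb nb)))"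
        by (subst sum.swap) (simp add: sum_distrib_left right_diff_distrib sum_subtractf)
      also have "\<dots> = (\<Sum>\<alpha> \<in> I. \<theta> \<alpha> * trigV (E \<alpha>) k l l lb nb)"
        using E trigV_diag[OF _ i jm] j by (intro sum.cong refl) simp
      finally show ?thesis
        using n by simp
    next
      assume "n \<notin> steps k l \<or> \<not> interlaces k nb n"
      then have "trigV D k l n lb nb = 0" "\<forall>\<alpha> \<in> I. trigV (E \<alpha>) k l n lb nb = 0"
        using D(2) E lb n unfolding trigV_rules_def by blast+
      then show ?thesis by simp
    qed (simp add: j V[OF jm])
  qed
qed

end

section \<open>Mixing weights read off from the push and pull probabilities\<close>

text \<open>Only the value on the slice of level \<open>k\<close> matters below; the entries 1 elsewhere are arbitrary.\<close>

definition push_rule :: "nat \<Rightarrow> nat \<Rightarrow> nat \<Rightarrow> nat \<Rightarrow> slice_rule" where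
  "push_rule N k h = (\<lambda>k'. RPush ((\<lambda>i \<in> {1..N - 1}. if i = k - 1 then h else 1) (k' - 1)))"

definition pull_rule :: "nat \<Rightarrow> nat \<Rightarrow> nat \<Rightarrow> nat \<Rightarrow> slice_rule" where
  "pull_rule N k h = (\<lambda>k'. LPull ((\<lambda>i \<in> {1..N - 1}. if i = k - 1 then h else 1) (k' - 1)))"

lemma push_pull_rules:
  assumes "k \<in> {2..N}" "h \<in> {1..k - 1}"
  shows "push_rule N k h \<in> fundamental_rules N" "pull_rule N k h \<in> fundamental_rules N"
    "push_rule N k h k = RPush h" "pull_rule N k h k = LPull h"
proof -
  \<comment> \<open>The slice of levels \<open>k - 1\<close>, \<open>k\<close> reads entry
    \<open>k - 1\<close>, whose box \<open>{1..k - 1}\<close> is the range of \<open>h\<close>; the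
    value 1 lies in every box.\<close>
  have "(\<lambda>i \<in> {1..N - 1}. if i = k - 1 then h else 1) \<in> (\<Pi>\<^sub>E i \<in> {1..N - 1}. {1..i})"
    using assms by auto
  then show "push_rule N k h \<in> fundamental_rules N" "pull_rule N k h \<in> fundamental_rules N"
    unfolding push_rule_def pull_rule_def fundamental_rules_def RPush_rules_def LPull_rules_def
    by blast+
  show "push_rule N k h k = RPush h" "pull_rule N k h k = LPull h"
    using assms by (auto simp: push_rule_def pull_rule_def)
qed

definition push_prob :: "mdyn \<Rightarrow> nat \<Rightarrow> signature \<Rightarrow> signature \<Rightarrow> nat \<Rightarrow> real" where
  "push_prob D k nb l j = trigV D k l (up (xi k nb l j) l) (down j nb) nb"

definition pull_prob :: "mdyn \<Rightarrow> nat \<Rightarrow> signature \<Rightarrow> signature \<Rightarrow> nat \<Rightarrow> real" where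
  "pull_prob D k nb l j = trigV D k l (up (j + 1) l) (down j nb) nb"

text \<open>Many rule vectors agree at \<open>k\<close>, so the weight is put on one chosen
  representative per push or pull index; comparing only the values at \<open>k\<close> would count
  it repeatedly.\<close>

definition mixing_weight ::
    "nat \<Rightarrow> mdyn \<Rightarrow> nat \<Rightarrow> (nat \<Rightarrow> slice_rule) \<Rightarrow> signature \<Rightarrow> signature \<Rightarrow> real" where
  "mixing_weight N D k \<rho> nb l =
     of_bool (\<rho> = (\<lambda>_. PB)) * (1 - (\<Sum>j \<in> moves k nb l. push_prob D k nb l j + pull_prob D k nb l j)) +
     (\<Sum>j \<in> moves k nb l. of_bool (\<rho> = push_rule N k j) * push_prob D k nb l j +
        of_bool (\<rho> = pull_rule N k j) * pull_prob D k nb l j)"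

text \<open>Every representative belongs to \<open>fundamental_rules N\<close>, so each indicator
  picks exactly one term. A constant \<open>g\<close> gives the normalization, and triggered
  probabilities as \<open>g\<close> give the mixture.\<close>

lemma sum_mixing_weight:
  assumes "k \<in> {2..N}"
  shows "(\<Sum>\<rho> \<in> fundamental_rules N. mixing_weight N D k \<rho> nb l * g \<rho>) =
    (1 - (\<Sum>j \<in> moves k nb l. push_prob D k nb l j + pull_prob D k nb l j)) * g (\<lambda>_. PB) +
    (\<Sum>j \<in> moves k nb l. push_prob D k nb l j * g (push_rule N k j) +
       pull_prob D k nb l j * g (pull_rule N k j))"
proof -
  let ?I = "fundamental_rules N"
  have pick: "(\<Sum>\<rho> \<in> ?I. of_bool (\<rho> = \<sigma>) * c * g \<rho>) = c * g \<sigma>" if "\<sigma> \<in> ?I" for \<sigma> and c :: real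
  proof -
    have "(\<Sum>\<rho> \<in> ?I. of_bool (\<rho> = \<sigma>) * c * g \<rho>) = (\<Sum>\<rho> \<in> ?I. if \<rho> = \<sigma> then c * g \<sigma> else 0)"
      by (intro sum.cong) auto
    then show ?thesis
      using that finite_fundamental_rules by simp
  qed
  have PB: "(\<lambda>_. PB) \<in> ?I"
    by (simp add: fundamental_rules_def PB_rules_def)
  have "(\<Sum>\<rho> \<in> ?I. (\<Sum>j \<in> moves k nb l. of_bool (\<rho> = push_rule N k j) * push_prob D k nb l j +
        of_bool (\<rho> = pull_rule N k j) * pull_prob D k nb l j) * g \<rho>) =
      (\<Sum>j \<in> moves k nb l. \<Sum>\<rho> \<in> ?I. of_bool (\<rho> = push_rule N k j) * push_prob D k nb l j * g \<rho> +
        of_bool (\<rho> = pull_rule N k j) * pull_prob D k nb l j * g \<rho>)"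
    by (subst sum.swap) (simp add: sum_distrib_right distrib_right)
  also have "\<dots> = (\<Sum>j \<in> moves k nb l. push_prob D k nb l j * g (push_rule N k j) +
       pull_prob D k nb l j * g (pull_rule N k j))"
    using push_pull_rules[OF assms]
    by (intro sum.cong refl) (simp add: sum.distrib pick moves_def)
  finally show ?thesis
    unfolding mixing_weight_def distrib_right sum.distrib pick[OF PB] by simp
qed

text \<open>Since \<open>xi k nb l j <= j < j + 1\<close>, the two allowed targets are distinct and
  at most one indicator is 1.\<close>

lemma trigV_nearest_neighbor:
  assumes D: "nearest_neighbor q t a N D" and k: "k \<in> {2..N}" and i: "interlaces k nb l"
    and j: "j \<in> moves k nb l" and m: "m \<in> Fset k nb l"
  shows "trigV D k l (up m l) (down j nb) nb =
    of_bool (m = xi k nb l j) * push_prob D k nb l j + of_bool (m = j + 1) * pull_prob D k nb l j"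
proof -
  have "xi k nb l j \<noteq> j + 1"
    using xi_in(2)[of k j nb l] k j by (auto simp: moves_def)
  moreover have "trigV D k l (up m l) (down j nb) nb = 0" if "m \<noteq> j + 1" "m \<noteq> xi k nb l j"
  proof -
    have "up m l \<in> GT k" "m \<in> {1..k}"
      using m interlaces_up_iff[OF i, of m] by (auto simp: interlaces_def Fset_def)
    then show ?thesis
      using D k i j that by (simp add: nearest_neighbor_def moves_def)
  qed
  ultimately show ?thesis
    by (auto simp: push_prob_def pull_prob_def)
qed

theorem theorem1p3:
  fixes N :: nat and q t :: real and a :: "nat \<Rightarrow> real" and D :: mdyn
  assumes "N \<ge> 1"
    and "0 \<le> q" "q < 1" "0 \<le> t" "t < 1"
    and "\<forall>k \<in> {1..N}. a k > 0"
    and "nearest_neighbor q t a N D"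
  shows "(\<forall>\<rho> \<in> fundamental_rules N. nearest_neighbor q t a N (dyn_of q t a \<rho>)) \<and>
         mixing q t a N (fundamental_rules N) (dyn_of q t a) D"
proof -
  interpret macdonald q t a N
    using assms by unfold_locales auto
  have D: "dynamics q t a N D"
    using assms by (simp add: nearest_neighbor_def)
  have nn: "nearest_neighbor q t a N (dyn_of q t a \<rho>)" if "\<rho> \<in> fundamental_rules N" for \<rho>
    using admissible_fundamental[OF that] by (rule nearest_neighbor_dyn_of[OF D])
  then have dyn: "dynamics q t a N (dyn_of q t a \<rho>)" if "\<rho> \<in> fundamental_rules N" for \<rho>
    using that by (simp add: nearest_neighbor_def)
  have slice: "rateW_rules k E \<and> trigV_rules k E \<and> balanced k E"
    if "dynamics q t a N E" "k \<in> {2..N}" for k E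
    using that consistent_iff[OF that(2), of E] by (auto simp: dynamics_iff)
  have one: "(\<Sum>\<rho> \<in> fundamental_rules N. mixing_weight N D k \<rho> nb l) = 1" if "k \<in> {2..N}" for k nb l
    using sum_mixing_weight[OF that, of D nb l "\<lambda>_. 1"] by simp
  have V: "trigV D k l (up m l) (down j nb) nb = (\<Sum>\<rho> \<in> fundamental_rules N.
      mixing_weight N D k \<rho> nb l * trigV (dyn_of q t a \<rho>) k l (up m l) (down j nb) nb)"
    if k: "k \<in> {2..N}" and i: "interlaces k nb l" and j: "j \<in> moves k nb l" and m: "m \<in> Fset k nb l"
    for k nb l j m
  proof -
    have "(\<Sum>\<rho> \<in> fundamental_rules N.
        mixing_weight N D k \<rho> nb l * trigV (dyn_of q t a \<rho>) k l (up m l) (down j nb) nb) =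
        (\<Sum>h \<in> moves k nb l. push_prob D k nb l h * slice_V q t (push_rule N k h k) k nb l j m +
           pull_prob D k nb l h * slice_V q t (pull_rule N k h k) k nb l j m)"
      by (simp add: trigV_dyn_of[OF i j m] sum_mixing_weight[OF k])
    \<comment> \<open>R(h) and L(h) respond only to the move \<open>j = h\<close>, each with its own
      target, while PB never triggers a move.\<close>
    also have "\<dots> = (\<Sum>h \<in> moves k nb l. if h = j then
        of_bool (m = xi k nb l j) * push_prob D k nb l j + of_bool (m = j + 1) * pull_prob D k nb l j
        else 0)"
      using push_pull_rules(3,4)[OF k] by (intro sum.cong refl) (auto simp: moves_def)
    also have "\<dots> = trigV D k l (up m l) (down j nb) nb"
      using j trigV_nearest_neighbor[OF assms(7) k i j m] by simp
    finally show ?thesis ..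
  qed
  have "mixing q t a N (fundamental_rules N) (dyn_of q t a) D"
    unfolding mixing_def
  proof (intro conjI ballI dyn D finite_fundamental_rules exI[of _ "mixing_weight N D"] allI impI)
    fix k l nb assume k: "k \<in> {2..N}" and i: "interlaces k nb l"
    have slice_D: "rateW_rules k D" "trigV_rules k D" "balanced k D"
      using slice[OF D k] by auto
    note mix = mixture_on_slice[OF k i slice_D slice[OF dyn k] one[OF k] V[OF k i]]
    show "(\<Sum>\<rho> \<in> fundamental_rules N. mixing_weight N D k \<rho> nb l) = 1"
      using k by (rule one)
    fix n assume n: "n \<in> GT k"
    show "rateW D k l n nb = (\<Sum>\<rho> \<in> fundamental_rules N.
        mixing_weight N D k \<rho> nb l * rateW (dyn_of q t a \<rho>) k l n nb)"
      using n by (intro mix(1))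
    fix lb assume "interlaces k lb l \<and> nb \<in> steps (k - 1) lb"
    then show "trigV D k l n lb nb = (\<Sum>\<rho> \<in> fundamental_rules N.
        mixing_weight N D k \<rho> nb l * trigV (dyn_of q t a \<rho>) k l n lb nb)"
      using n by (intro mix(2)) auto
  qed
  with nn show ?thesis by blast
qed

end
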